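(* Assume (A1)–(A4) hold and that $\operatorname{dom} h$ has finite diameter $D_h>0$. Let a positive integer $K$ and a constant $C\ge1$ be given, let $(D,M)$ be a pair of positive reals (an estimate for the pair $(D_h,\bar M)$), and define $$\theta=\frac CK,\qquad R=\frac DM,\qquad \lambda=\frac{\sqrt C\,D}{M\sqrt K}.$$ Then, with $\kappa_D:=D_h^2/D^2$ and $\kappa_M:=\bar M^2/M^2$, SCPB1 with input $(\lambda,\theta,K)$ and constant $R$ satisfies: (a) $$\mathbb{E}[\phi(\hat y_K^a)]-\phi_*\le\frac{(4\kappa_D+5\kappa_M)DM}{\sqrt{CK}};$$ (b) the number of iterations within the $k$-th cycle $\mathcal{C}_k$ is bounded by $$\left\lceil(C+1)\ln_0^+\!\left(\frac{\sqrt C\,k}{\sqrt K}\right)\right\rceil+1,$$ and hence, up to a logarithmic term, is $\mathcal{O}(C)$, i.e. bounded by an absolute constant times $C\big(1+\ln_0^+(\sqrt C\,k/\sqrt K)\big)$; (c) the expected overall iteration complexity (expected total number of iterations over all $K$ cycles) is, up to a logarithmic term, $\mathcal{O}(CK)$, i.e. bounded by an absolute constant times $CK\big(1+\ln_0^+(\sqrt{CK})\big)$.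
   Context: Problem. $\xi$ is a random vector with support $\Xi$. Consider $\phi_*:=\min\{\phi(x):=f(x)+h(x): x\in\mathbb{R}^n\}$ with $f(x)=\mathbb{E}_\xi[F(x,\xi)]$. Here $\mathbb{R}^n$ has its Euclidean inner product $\langle\cdot,\cdot\rangle$ and norm $\|\cdot\|$. Assumptions. (A1) $f$ and $h$ are proper closed convex functions from $\mathbb{R}^n$ to $\mathbb{R}\cup\{+\infty\}$ with $\operatorname{dom} f\supset\operatorname{dom} h$. (A2) For almost every $\xi\in\Xi$ there are available a functional oracle $F(\cdot,\xi):\operatorname{dom} h\to\mathbb{R}$ and a stochastic subgradient oracle $s(\cdot,\xi):\operatorname{dom} h\to\mathbb{R}^n$ such that $f(x)=\mathbb{E}[F(x,\xi)]$ and $f'(x):=\mathbb{E}[s(x,\xi)]\in\partial f(x)$ for every $x\in\operatorname{dom} h$ ($F(\cdot,\xi)$ need not be convex). (A3) $\bar M:=\sup\{\mathbb{E}[\|s(x,\xi)\|^2]^{1/2}:x\in\operatorname{dom} h\}<\infty$. (A4) The set $X^*$ of optimal solutions is nonempty. SCPB scheme. Input: $\lambda,\theta>0$, integer $K\ge1$, $x_0\in\operatorname{dom} h$. Let $\tau=\theta K/(\theta K+1)$, $j_0=0$, and let $\xi_0,\xi_1,\dots$ be independent samples of $\xi$ (iteration $j$ draws $\xi_{j-1}$, independent of $\xi_0,\dots,\xi_{j-2}$). Iterations $j=1,2,\dots$ are grouped into $K$ consecutive cycles $\mathcal{C}_k=\{i_k,\dots,j_k\}$, $k=1,\dots,K$,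 where $i_k:=j_{k-1}+1$ and the integer $j_k\ge i_k$ is given by a cycle rule. For $j\in\mathcal{C}_k$: the prox-center is $x_j^c=x_{j_{k-1}}$; $S_j=s(x_{j_{k-1}},\xi_{j_{k-1}})$ if $j=i_k$ and $S_j=(1-\tau)s(x_{j-1},\xi_{j-1})+\tau S_{j-1}$ otherwise; $$x_j=\operatorname{argmin}_{u\in\mathbb{R}^n}\Big\{h(u)+\langle S_j,u\rangle+\tfrac1{2\lambda}\|u-x_j^c\|^2\Big\};$$ $y_j=x_j$ if $j=i_k$ and $y_j=(1-\tau)x_j+\tau y_{j-1}$ otherwise. Set $\hat y_k=y_{j_k}$. The output is $\hat y_K^a=\frac1{\lceil K/2\rceil}\sum_{k=\lfloor K/2\rfloor+1}^K\hat y_k$. SCPB1 (with constant $R>0$) is the SCPB scheme with the cycle rule: for every $k\ge1$, $j_k$ is the smallest integer $\ge i_k$ such that $\lambda k\,\tau^{j_k-i_k}\le R$. Notation: $\ln_0^+(\cdot)=\max\{0,\ln(\cdot)\}$. *)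

theory Defs
  imports "HOL-Probability.Probability"
begin

section \<open>Convex functions with values in the reals extended by plus infinity\<close>

definition edom :: "('a \<Rightarrow> ereal) \<Rightarrow> 'a set" where
  "edom g = {x. g x < \<infinity>}"

definition eepigraph :: "('a \<Rightarrow> ereal) \<Rightarrow> ('a \<times> real) set" where
  "eepigraph g = {(x, t). g x \<le> ereal t}"

definition proper_closed_convex :: "('a::euclidean_space \<Rightarrow> ereal) \<Rightarrow> bool" where
  "proper_closed_convex g \<longleftrightarrow>
     (\<forall>x. g x \<noteq> -\<infinity>) \<and> edom g \<noteq> {} \<and> closed (eepigraph g) \<and> convex (eepigraph g)"

definition subdifferential :: "('a::euclidean_space \<Rightarrow> ereal) \<Rightarrow> 'a \<Rightarrow> 'a set" where
  "subdifferential g x = {v. \<forall>u. g x + ereal (v \<bullet> (u - x)) \<le> g u}"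

definition optimal_solutions :: "('a \<Rightarrow> ereal) \<Rightarrow> 'a set" where
  "optimal_solutions g = {x. is_arg_min g (\<lambda>_. True) x}"

definition ln0p :: "real \<Rightarrow> real" where
  "ln0p t = max 0 (ln t)"


section \<open>Stochastic oracles\<close>

text \<open>
  The oracles are total functions of both arguments; only their values at points of
  \<open>edom h\<close> are constrained. Oracles available only for almost every sample are covered by extending
  them measurably (for instance by zero) to the exceptional null set. Joint measurability of \<open>s\<close> on \<open>edom h\<close> times the sample space is
  what makes the stochastic subgradients at the random iterates of the scheme random vectors.
\<close>

definition stochastic_oracles ::
  "'w measure \<Rightarrow> ('w \<Rightarrow> 'b::euclidean_space) \<Rightarrow> ('a::euclidean_space \<Rightarrow> ereal) \<Rightarrow> ('a \<Rightarrow> ereal)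
   \<Rightarrow> ('a \<Rightarrow> 'b \<Rightarrow> real) \<Rightarrow> ('a \<Rightarrow> 'b \<Rightarrow> 'a) \<Rightarrow> bool" where
  "stochastic_oracles P \<xi> f h F s \<longleftrightarrow>
     (\<lambda>(x, z). s x z) \<in> borel_measurable (restrict_space borel (edom h) \<Otimes>\<^sub>M borel) \<and>
     (\<forall>x\<in>edom h.
        integrable P (\<lambda>\<omega>. F x (\<xi> \<omega>)) \<and> f x = ereal (\<integral>\<omega>. F x (\<xi> \<omega>) \<partial>P) \<and>
        integrable P (\<lambda>\<omega>. s x (\<xi> \<omega>)) \<and> (\<integral>\<omega>. s x (\<xi> \<omega>) \<partial>P) \<in> subdifferential f x)"

definition oracle_rms :: "'w measure \<Rightarrow> ('w \<Rightarrow> 'b) \<Rightarrow> ('a \<Rightarrow> 'b \<Rightarrow> 'a::euclidean_space) \<Rightarrow> 'a \<Rightarrow> real"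
  where "oracle_rms P \<xi> s x = sqrt (\<integral>\<omega>. (norm (s x (\<xi> \<omega>)))\<^sup>2 \<partial>P)"

definition oracle_bound ::
  "'w measure \<Rightarrow> ('w \<Rightarrow> 'b) \<Rightarrow> ('a::euclidean_space \<Rightarrow> ereal) \<Rightarrow> ('a \<Rightarrow> 'b \<Rightarrow> 'a) \<Rightarrow> real" where
  "oracle_bound P \<xi> h s = (SUP x\<in>edom h. oracle_rms P \<xi> s x)"

text \<open>The supremum of the root mean squares in \<open>oracle_bound\<close>, taken in the extended reals,
  is finite.\<close>

definition finite_oracle_bound ::
  "'w measure \<Rightarrow> ('w \<Rightarrow> 'b) \<Rightarrow> ('a::euclidean_space \<Rightarrow> ereal) \<Rightarrow> ('a \<Rightarrow> 'b \<Rightarrow> 'a) \<Rightarrow> bool" where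
  "finite_oracle_bound P \<xi> h s \<longleftrightarrow>
     (\<forall>x\<in>edom h. integrable P (\<lambda>\<omega>. (norm (s x (\<xi> \<omega>)))\<^sup>2)) \<and>
     bdd_above (oracle_rms P \<xi> s ` edom h)"


section \<open>The SCPB scheme\<close>

text \<open>
  Both predicates describe a single realization: \<open>z i\<close> is the value of the \<open>i\<close>-th sample, and
  \<open>j k\<close> is the last iteration of cycle \<open>k\<close>, so that the first one is \<open>j (k - 1) + 1\<close>. Iteration
  \<open>i\<close> uses the sample \<open>z (i - 1)\<close>. Nothing is prescribed beyond iteration \<open>j K\<close>.
\<close>

definition SCPB ::
  "('a::euclidean_space \<Rightarrow> ereal) \<Rightarrow> ('a \<Rightarrow> 'b \<Rightarrow> 'a) \<Rightarrow> real \<Rightarrow> real \<Rightarrow> nat \<Rightarrow> 'a \<Rightarrow> (nat \<Rightarrow> 'b)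
   \<Rightarrow> (nat \<Rightarrow> nat) \<Rightarrow> (nat \<Rightarrow> 'a) \<Rightarrow> (nat \<Rightarrow> 'a) \<Rightarrow> (nat \<Rightarrow> 'a) \<Rightarrow> bool" where
  "SCPB h s lam \<theta> K x0 z j S x y \<longleftrightarrow>
     (let \<tau> = \<theta> * real K / (\<theta> * real K + 1) in
        j 0 = 0 \<and> x 0 = x0 \<and>
        (\<forall>k\<in>{1..K}.
           let i\<^sub>k = j (k - 1) + 1; xc = x (j (k - 1)) in
             i\<^sub>k \<le> j k \<and>
             (\<forall>i\<in>{i\<^sub>k..j k}.
                S i = (if i = i\<^sub>k then s xc (z (j (k - 1)))
                       else (1 - \<tau>) *\<^sub>R s (x (i - 1)) (z (i - 1)) + \<tau> *\<^sub>R S (i - 1)) \<and>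
                is_arg_min (\<lambda>u. h u + ereal (S i \<bullet> u + 1 / (2 * lam) * (norm (u - xc))\<^sup>2))
                  (\<lambda>_. True) (x i) \<and>
                y i = (if i = i\<^sub>k then x i else (1 - \<tau>) *\<^sub>R x i + \<tau> *\<^sub>R y (i - 1)))))"

definition SCPB1 ::
  "('a::euclidean_space \<Rightarrow> ereal) \<Rightarrow> ('a \<Rightarrow> 'b \<Rightarrow> 'a) \<Rightarrow> real \<Rightarrow> real \<Rightarrow> nat \<Rightarrow> real \<Rightarrow> 'a \<Rightarrow> (nat \<Rightarrow> 'b)
   \<Rightarrow> (nat \<Rightarrow> nat) \<Rightarrow> (nat \<Rightarrow> 'a) \<Rightarrow> (nat \<Rightarrow> 'a) \<Rightarrow> (nat \<Rightarrow> 'a) \<Rightarrow> bool" where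
  "SCPB1 h s lam \<theta> K R x0 z j S x y \<longleftrightarrow>
     SCPB h s lam \<theta> K x0 z j S x y \<and>
     (let \<tau> = \<theta> * real K / (\<theta> * real K + 1) in
        \<forall>k\<in>{1..K}.
          let i\<^sub>k = j (k - 1) + 1 in
            is_arg_min (\<lambda>l. l) (\<lambda>l. i\<^sub>k \<le> l \<and> lam * real k * \<tau> ^ (l - i\<^sub>k) \<le> R) (j k))"

definition SCPB_output :: "nat \<Rightarrow> (nat \<Rightarrow> nat) \<Rightarrow> (nat \<Rightarrow> 'a::real_vector) \<Rightarrow> 'a" where
  "SCPB_output K j y = (1 / of_int \<lceil>real K / 2\<rceil>) *\<^sub>R (\<Sum>k = K div 2 + 1..K. y (j k))"

end

theory Submission
  imports Defs
begin

text \<open>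
  Within a cycle, \<open>S\<close> and \<open>y\<close> are exponential moving averages with factor \<open>\<tau>\<close>, so the minimized models are
  moving averages of the stochastic linearizations of \<open>f\<close>. Strong convexity of the proximal subproblems shows that the
  gap between the averaged objective values and the model minimum contracts by \<open>\<tau>\<close> in each step, up to a noise term
  of order \<open>(1 - \<tau>) \<lambda> (\<parallel>s\<parallel> + B)\<^sup>2 / (\<theta> K)\<close>, while the gap of the first step is at most \<open>(\<parallel>s\<parallel> + B) D\<^sub>h\<close>,
  where \<open>s\<close> is the stochastic subgradient drawn and \<open>B\<close> is the oracle bound.
  The cycle rule makes the final weight \<open>\<tau> ^ (j\<^sub>k - i\<^sub>k)\<close> of this first gap at most \<open>R / (\<lambda> k)\<close>, that is \<open>O(1 / K)\<close> for
  the cycles that are averaged in the output. The proximal terms telescope over the cycles.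
  In expectation the linearizations are below \<open>f\<close>: the cycle ends are deterministic, hence each iterate is a
  function of past samples only and Fubini's theorem applies to the next, independent sample.
\<close>

section \<open>Exponential moving averages\<close>

primrec ema :: "real \<Rightarrow> (nat \<Rightarrow> 'a::real_vector) \<Rightarrow> nat \<Rightarrow> 'a" where
  "ema \<tau> a 0 = a 0"
| "ema \<tau> a (Suc n) = (1 - \<tau>) *\<^sub>R a (Suc n) + \<tau> *\<^sub>R ema \<tau> a n"

lemma ema_const: "ema \<tau> (\<lambda>_. c) n = c"
  by (induction n) (simp_all flip: scaleR_add_left)

lemma ema_add: "ema \<tau> (\<lambda>t. a t + b t) n = ema \<tau> a n + ema \<tau> b n"
  by (induction n) (simp_all add: algebra_simps)

lemma ema_mono:
  fixes a b :: "nat \<Rightarrow> real"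
  assumes "0 \<le> \<tau>" "\<tau> \<le> 1" "\<And>t. t \<le> n \<Longrightarrow> a t \<le> b t"
  shows "ema \<tau> a n \<le> ema \<tau> b n"
  using assms(3)
proof (induction n)
  case (Suc n)
  then show ?case
    using assms(1,2) by (auto intro!: add_mono mult_left_mono)
qed simp

text \<open>The weights of the average sum to one and the initial entry carries
  \<open>\<tau> ^ n\<close>; this is the weight that the cycle rule makes small.\<close>

lemma ema_first_rest:
  fixes a b :: real
  shows "ema \<tau> (\<lambda>t. if t = 0 then a else b) n = \<tau> ^ n * a + (1 - \<tau> ^ n) * b"
proof (induction n)
  case (Suc n)
  show ?case
    by (simp add: Suc) (simp add: algebra_simps)
qed simp

lemma ema_inner: "ema \<tau> (\<lambda>t. a t \<bullet> u) n = ema \<tau> a n \<bullet> u"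
  by (induction n) (simp_all add: inner_simps)

lemma ema_in_convex:
  assumes "convex X" "0 \<le> \<tau>" "\<tau> \<le> 1" "\<And>t. t \<le> n \<Longrightarrow> a t \<in> X"
  shows "ema \<tau> a n \<in> X"
  using assms(4)
proof (induction n)
  case (Suc n)
  then show ?case
    using assms(1-3) by (auto intro!: convexD)
qed simp

lemma ema_jensen:
  assumes "convex_on X g" "0 \<le> \<tau>" "\<tau> \<le> 1" "\<And>t. t \<le> n \<Longrightarrow> a t \<in> X"
  shows "g (ema \<tau> a n) \<le> ema \<tau> (\<lambda>t. g (a t)) n"
  using assms(4)
proof (induction n)
  case (Suc n)
  have X: "convex X"
    using assms(1) by (rule convex_on_imp_convex)
  have "g (ema \<tau> a (Suc n)) \<le> (1 - \<tau>) * g (a (Suc n)) + \<tau> * g (ema \<tau> a n)"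
    using convex_onD[OF assms(1) assms(2,3), of "a (Suc n)" "ema \<tau> a n"]
      ema_in_convex[OF X assms(2,3)] Suc.prems by auto
  also have "\<dots> \<le> (1 - \<tau>) * g (a (Suc n)) + \<tau> * ema \<tau> (\<lambda>t. g (a t)) n"
    using Suc assms(2) by (intro add_left_mono mult_left_mono) auto
  finally show ?case
    by simp
qed simp

lemma ema_measurable:
  fixes a :: "nat \<Rightarrow> 'w \<Rightarrow> 'a::{real_normed_vector, second_countable_topology}"
  assumes "\<And>t. t \<le> n \<Longrightarrow> a t \<in> borel_measurable N"
  shows "(\<lambda>\<omega>. ema \<tau> (\<lambda>t. a t \<omega>) n) \<in> borel_measurable N"
  using assms
proof (induction n)
  case (Suc n)
  then have [measurable]: "a (Suc n) \<in> borel_measurable N" "(\<lambda>\<omega>. ema \<tau> (\<lambda>t. a t \<omega>) n) \<in> borel_measurable N"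
    by auto
  show ?case
    by simp
qed simp

lemma integrable_ema:
  fixes a :: "nat \<Rightarrow> 'w \<Rightarrow> real"
  assumes "\<And>t. t \<le> n \<Longrightarrow> integrable P (a t)"
  shows "integrable P (\<lambda>\<omega>. ema \<tau> (\<lambda>t. a t \<omega>) n)"
  using assms by (induction n) auto

lemma integral_ema:
  fixes a :: "nat \<Rightarrow> 'w \<Rightarrow> real"
  assumes "\<And>t. t \<le> n \<Longrightarrow> integrable P (a t)"
  shows "(\<integral>\<omega>. ema \<tau> (\<lambda>t. a t \<omega>) n \<partial>P) = ema \<tau> (\<lambda>t. \<integral>\<omega>. a t \<omega> \<partial>P) n"
  using assms
proof (induction n)
  case (Suc n)
  then have "integrable P (a (Suc n))" "integrable P (\<lambda>\<omega>. ema \<tau> (\<lambda>t. a t \<omega>) n)"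
    by (auto intro: integrable_ema)
  then show ?case
    using Suc by simp
qed simp

text \<open>The last term is the exact strong convexity of the squared distance along a segment; it
  becomes the quadratic growth of the proximal subproblem.\<close>

lemma norm_segment_sq:
  fixes x u c :: "'a::real_inner"
  shows "(norm ((1 - t) *\<^sub>R x + t *\<^sub>R u - c))\<^sup>2 =
    (1 - t) * (norm (x - c))\<^sup>2 + t * (norm (u - c))\<^sup>2 - t * (1 - t) * (norm (u - x))\<^sup>2"
  unfolding power2_norm_eq_inner
  by (simp add: inner_simps inner_commute algebra_simps power2_eq_square)

section \<open>Proximal steps and the deterministic bound for one cycle\<close>

text \<open>The proximal subproblem in real-valued form: the value plus infinity of \<open>h\<close>
  is replaced by the restriction to \<open>X\<close>, so that convexity can be used through
  \<open>convex_on\<close>.\<close>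

definition prox_step :: "'a::real_inner set \<Rightarrow> ('a \<Rightarrow> real) \<Rightarrow> real \<Rightarrow> 'a \<Rightarrow> 'a \<Rightarrow> 'a \<Rightarrow> bool" where
  "prox_step X h lam S c x \<longleftrightarrow> x \<in> X \<and>
     (\<forall>u\<in>X. h x + (S \<bullet> x + 1 / (2 * lam) * (norm (x - c))\<^sup>2)
          \<le> h u + (S \<bullet> u + 1 / (2 * lam) * (norm (u - c))\<^sup>2))"

lemma prox_step_three_point:
  assumes h: "convex_on X h" and lam: "lam > 0" and px: "prox_step X h lam S c x" and u: "u \<in> X"
  shows "h x + S \<bullet> x + 1 / (2 * lam) * (norm (x - c))\<^sup>2 + 1 / (2 * lam) * (norm (u - x))\<^sup>2
    \<le> h u + S \<bullet> u + 1 / (2 * lam) * (norm (u - c))\<^sup>2"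
proof -
  define a where "a = 1 / (2 * lam)"
  define Q where "Q v = h v + S \<bullet> v + a * (norm (v - c))\<^sup>2" for v
  have x: "x \<in> X" and min: "\<And>v. v \<in> X \<Longrightarrow> Q x \<le> Q v"
    using px by (auto simp: prox_step_def Q_def a_def add.assoc)
  have "a * (norm (u - x))\<^sup>2 \<le> Q u - Q x"
  \<comment> \<open>\<open>x\<close> is compared with the point at parameter \<open>t\<close> of the
    segment towards \<open>u\<close>. Dividing by \<open>t\<close> leaves the growth term with
    factor \<open>z = 1 - t\<close>, and \<open>z\<close> tends to 1.\<close>
  proof (rule field_le_mult_one_interval)
    fix z :: real
    assume z: "0 < z" "z < 1"
    define t where "t = 1 - z"
    have t: "0 < t" "t < 1"
      using z by (auto simp: t_def)
    let ?v = "(1 - t) *\<^sub>R x + t *\<^sub>R u"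
    have v: "?v \<in> X"
      using convex_on_imp_convex[OF h] x u t by (auto intro!: convexD)
    have "h ?v \<le> (1 - t) * h x + t * h u"
      using convex_onD[OF h, of t x u] x u t by simp
    then have "Q ?v \<le> (1 - t) * Q x + t * Q u - a * (t * (1 - t) * (norm (u - x))\<^sup>2)"
      unfolding Q_def norm_segment_sq by (simp add: inner_simps algebra_simps)
    with min[OF v] have "t * (z * (a * (norm (u - x))\<^sup>2)) \<le> t * (Q u - Q x)"
      by (simp add: t_def algebra_simps)
    then show "z * (a * (norm (u - x))\<^sup>2) \<le> Q u - Q x"
      using t by simp
  qed
  then show ?thesis
    by (simp add: Q_def a_def)
qed

text \<open>Each minimizer is tested at the other one; in the sum of the two inequalities
  \<open>h\<close> cancels and firm nonexpansiveness in the shifted center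
  \<open>c - lam *\<^sub>R S\<close> remains. It serves the measurability of the iterates.\<close>

lemma prox_step_nonexpansive:
  assumes h: "convex_on X h" and lam: "lam > 0"
    and x: "prox_step X h lam S c x" and x': "prox_step X h lam S' c' x'"
  shows "norm (x - x') \<le> norm ((c - lam *\<^sub>R S) - (c' - lam *\<^sub>R S'))"
proof -
  let ?w = "(c - lam *\<^sub>R S) - (c' - lam *\<^sub>R S')"
  have "x \<in> X" "x' \<in> X"
    using x x' by (auto simp: prox_step_def)
  from prox_step_three_point[OF h lam x this(2)] prox_step_three_point[OF h lam x' this(1)]
  have "S \<bullet> x + S' \<bullet> x' - S \<bullet> x' - S' \<bullet> x + 1 / (2 * lam) *
     ((norm (x - c))\<^sup>2 + (norm (x' - c'))\<^sup>2 + 2 * (norm (x - x'))\<^sup>2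
      - (norm (x' - c))\<^sup>2 - (norm (x - c'))\<^sup>2) \<le> 0"
    by (simp add: algebra_simps norm_minus_commute)
  moreover have "lam * (p + 1 / (2 * lam) * q) = lam * p + 1 / 2 * q" for p q
    using lam by (simp add: field_simps)
  ultimately
  have "lam * (S \<bullet> x + S' \<bullet> x' - S \<bullet> x' - S' \<bullet> x) + 1 / 2 *
     ((norm (x - c))\<^sup>2 + (norm (x' - c'))\<^sup>2 + 2 * (norm (x - x'))\<^sup>2
      - (norm (x' - c))\<^sup>2 - (norm (x - c'))\<^sup>2) \<le> 0"
    using lam by (metis mult_zero_right mult_le_cancel_left_pos)
  then have "(norm (x - x'))\<^sup>2 \<le> ?w \<bullet> (x - x')"
    unfolding power2_norm_eq_inner
    by (simp add: inner_simps inner_commute algebra_simps)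
  also have "\<dots> \<le> norm ?w * norm (x - x')"
    by (rule norm_cauchy_schwarz)
  finally show ?thesis
    by (cases "norm (x - x') = 0") (auto simp: power2_eq_square)
qed

text \<open>A completed square: the linear loss minus the quadratic gain is largest at
  \<open>d = (1 - \<tau>) * lam * g / \<tau>\<close>.\<close>

lemma quadratic_growth_absorbs_slope:
  fixes a d g \<tau> lam :: real
  assumes "0 < \<tau>" "lam > 0"
  shows "(1 - \<tau>) * (g * d) \<le> \<tau> * (1 / (2 * lam) * d\<^sup>2) + (1 - \<tau>) * ((1 - \<tau>) / \<tau> * (lam / 2) * g\<^sup>2)"
proof -
  have "0 \<le> \<tau> / (2 * lam) * (d - (1 - \<tau>) * lam / \<tau> * g)\<^sup>2"
    using assms by simp
  also have "\<dots> = \<tau> * (1 / (2 * lam) * d\<^sup>2) + (1 - \<tau>) * ((1 - \<tau>) / \<tau> * (lam / 2) * g\<^sup>2) - (1 - \<tau>) * (g * d)"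
    using assms by (simp add: field_simps power2_eq_square)
  finally show ?thesis
    by simp
qed

text \<open>
  \<open>x 0\<close> is the prox-center, \<open>x (Suc t)\<close> the iterate of step \<open>t\<close> and \<open>g t\<close> the stochastic subgradient at
  \<open>x t\<close>, so that the subgradient used at step \<open>t\<close> always sits at the previous point.
  The models \<open>\<Gamma> t\<close> satisfy \<open>\<Gamma> (Suc t) = (1 - \<tau>) (new cut) + \<tau> \<Gamma> t\<close>, and the quadratic growth of \<open>\<Gamma> t\<close>
  around its minimizer pays for the error of the new cut.
\<close>

lemma cycle_bound:
  fixes X :: "'a::real_inner set" and x g :: "nat \<Rightarrow> 'a"
  assumes f: "convex_on X f" and h: "convex_on X h" and lam: "lam > 0" and \<tau>: "0 < \<tau>" "\<tau> < 1"
    and lip: "\<And>v w. v \<in> X \<Longrightarrow> w \<in> X \<Longrightarrow> f v - f w \<le> B * norm (v - w)"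
    and diam: "\<And>v w. v \<in> X \<Longrightarrow> w \<in> X \<Longrightarrow> norm (v - w) \<le> d"
    and B: "B \<ge> 0"
    and x0: "x 0 \<in> X"
    and step: "\<And>t. t \<le> n \<Longrightarrow> prox_step X h lam (ema \<tau> g t) (x 0) (x (Suc t))"
    and u: "u \<in> X"
  defines "yn \<equiv> ema \<tau> (\<lambda>t. x (Suc t)) n"
  shows "f yn + h yn + 1 / (2 * lam) * (norm (u - x (Suc n)))\<^sup>2
    \<le> h u + ema \<tau> (\<lambda>t. f (x t) + g t \<bullet> (u - x t)) n + 1 / (2 * lam) * (norm (u - x 0))\<^sup>2
      + ema \<tau> (\<lambda>t. if t = 0 then (norm (g t) + B) * d
                  else (1 - \<tau>) / \<tau> * (lam / 2) * (norm (g t) + B)\<^sup>2) n"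
proof -
  define e where "e t = (if t = 0 then (norm (g t) + B) * d
                  else (1 - \<tau>) / \<tau> * (lam / 2) * (norm (g t) + B)\<^sup>2)" for t
  \<comment> \<open>\<open>A t\<close> collects the parts of the cuts that do not depend on the
    argument, so that \<open>\<Gamma> t\<close> is the averaged model together with \<open>h\<close>
    and the proximal term.\<close>
  define A where "A t = ema \<tau> (\<lambda>t. f (x t) - g t \<bullet> x t) t" for t
  define \<Gamma> where "\<Gamma> t v = h v + ema \<tau> g t \<bullet> v + 1 / (2 * lam) * (norm (v - x 0))\<^sup>2 + A t" for t v
  have xX: "x t \<in> X" if "t \<le> Suc n" for t
    using that x0 step by (cases t) (auto simp: prox_step_def)
  have grow: "\<Gamma> t (x (Suc t)) + 1 / (2 * lam) * (norm (v - x (Suc t)))\<^sup>2 \<le> \<Gamma> t v"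
    if "t \<le> n" "v \<in> X" for t v
    using prox_step_three_point[OF h lam step[OF that(1)] that(2)] by (simp add: \<Gamma>_def)
  \<comment> \<open>Lipschitz continuity of \<open>f\<close> and Cauchy-Schwarz for
    \<open>g t\<close> bound how far the cut at \<open>x t\<close> falls below \<open>f\<close> at
    the next iterate.\<close>
  have cut: "f (x (Suc t)) - (norm (g t) + B) * norm (x (Suc t) - x t)
      \<le> f (x t) + g t \<bullet> (x (Suc t) - x t)" if "t \<le> n" for t
    using lip[of "x (Suc t)" "x t"] xX[of t] xX[of "Suc t"] that
      norm_cauchy_schwarz[of "- g t" "x (Suc t) - x t"] by (simp add: algebra_simps)
  have \<Gamma>: "ema \<tau> (\<lambda>t. f (x (Suc t)) + h (x (Suc t))) t \<le> \<Gamma> t (x (Suc t)) + ema \<tau> e t"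
    if "t \<le> n" for t
    using that
  proof (induction t)
    \<comment> \<open>No earlier model can pay for the first step, so its length is bounded by the
      diameter.\<close>
    case 0
    have "norm (x (Suc 0) - x 0) \<le> d"
      using diam xX by simp
    then have "(norm (g 0) + B) * norm (x (Suc 0) - x 0) \<le> e 0"
      using B by (simp add: e_def mult_left_mono)
    moreover have "0 \<le> 1 / (2 * lam) * (norm (x (Suc 0) - x 0))\<^sup>2"
      using lam by simp
    ultimately show ?case
      using cut[of 0] by (simp add: \<Gamma>_def A_def inner_simps)
  next
    case (Suc t)
    let ?d = "norm (x (Suc (Suc t)) - x (Suc t))" and ?g = "norm (g (Suc t)) + B"
    let ?v = "x (Suc (Suc t))"
    have IH: "\<tau> * ema \<tau> (\<lambda>t. f (x (Suc t)) + h (x (Suc t))) t \<le> \<tau> * (\<Gamma> t (x (Suc t)) + ema \<tau> e t)"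
      using Suc \<tau> by simp
    have "\<tau> * (\<Gamma> t (x (Suc t)) + 1 / (2 * lam) * ?d\<^sup>2) \<le> \<tau> * \<Gamma> t ?v"
      using grow[of t ?v] xX[of "Suc (Suc t)"] Suc.prems \<tau> by simp
    moreover have "(1 - \<tau>) * (f ?v - ?g * ?d) \<le> (1 - \<tau>) * (f (x (Suc t)) + g (Suc t) \<bullet> (?v - x (Suc t)))"
      using cut[OF Suc.prems] \<tau> by simp
    \<comment> \<open>\<open>h\<close> and the proximal term are not averaged, so a share
      \<open>1 - \<tau>\<close> of each remains beside \<open>\<tau> * \<Gamma> t\<close>; of the
      proximal share only the sign is used.\<close>
    moreover have "0 \<le> (1 - \<tau>) * (1 / (2 * lam) * (norm (?v - x 0))\<^sup>2)"
      using \<tau> lam by simp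
    moreover have "\<Gamma> (Suc t) ?v = \<tau> * \<Gamma> t ?v + (1 - \<tau>) * h ?v
        + (1 - \<tau>) * (f (x (Suc t)) + g (Suc t) \<bullet> (?v - x (Suc t)))
        + (1 - \<tau>) * (1 / (2 * lam) * (norm (?v - x 0))\<^sup>2)"
    proof -
      obtain a where a: "1 / (2 * lam) = a"
        by simp
      show ?thesis
        unfolding \<Gamma>_def A_def a by (simp add: inner_simps algebra_simps)
    qed
    moreover have "(1 - \<tau>) * (?g * ?d) \<le> \<tau> * (1 / (2 * lam) * ?d\<^sup>2) + (1 - \<tau>) * e (Suc t)"
      unfolding e_def using quadratic_growth_absorbs_slope[of \<tau> lam ?g ?d] \<tau>(1) lam by simp
    ultimately show ?case
      using IH by (simp add: algebra_simps)
  qed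
  have "f yn + h yn \<le> ema \<tau> (\<lambda>t. f (x (Suc t)) + h (x (Suc t))) n"
    unfolding yn_def using convex_on_add[OF f h] \<tau> xX by (intro ema_jensen) auto
  also note \<Gamma>[OF order_refl]
  also have "\<Gamma> n (x (Suc n)) \<le> \<Gamma> n u - 1 / (2 * lam) * (norm (u - x (Suc n)))\<^sup>2"
    using grow[OF order_refl u] by simp
  also have "\<Gamma> n u = h u + ema \<tau> (\<lambda>t. f (x t) + g t \<bullet> (u - x t)) n + 1 / (2 * lam) * (norm (u - x 0))\<^sup>2"
    unfolding \<Gamma>_def A_def ema_inner[symmetric]
    by (simp add: ema_add[symmetric] algebra_simps)
  finally show ?thesis
    by (simp add: e_def algebra_simps)
qed

section \<open>Extended-valued convex functions and cycle lengths\<close>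

lemma proper_closed_convex_real:
  assumes "proper_closed_convex g" "x \<in> edom g"
  shows "g x = ereal (real_of_ereal (g x))"
  using assms by (cases "g x") (auto simp: proper_closed_convex_def edom_def)

lemma proper_closed_convex_segment:
  assumes g: "proper_closed_convex g" and "x \<in> edom g" "y \<in> edom g" "0 \<le> a" "0 \<le> b" "a + b = 1"
  shows "g (a *\<^sub>R x + b *\<^sub>R y) \<le> ereal (a * real_of_ereal (g x) + b * real_of_ereal (g y))"
proof -
  have "(x, real_of_ereal (g x)) \<in> eepigraph g" "(y, real_of_ereal (g y)) \<in> eepigraph g"
    using proper_closed_convex_real[OF g] assms by (auto simp: eepigraph_def)
  then have "a *\<^sub>R (x, real_of_ereal (g x)) + b *\<^sub>R (y, real_of_ereal (g y)) \<in> eepigraph g"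
    using g assms(4-6) unfolding proper_closed_convex_def by (intro convexD) auto
  then show ?thesis
    by (simp add: eepigraph_def)
qed

lemma convex_edom:
  assumes "proper_closed_convex g"
  shows "convex (edom g)"
proof (rule convexI)
  fix x y and a b :: real
  assume "x \<in> edom g" "y \<in> edom g" "0 \<le> a" "0 \<le> b" "a + b = 1"
  from proper_closed_convex_segment[OF assms this] show "a *\<^sub>R x + b *\<^sub>R y \<in> edom g"
    unfolding edom_def by (auto intro: le_less_trans)
qed

lemma convex_on_edom:
  assumes g: "proper_closed_convex g" and sub: "X \<subseteq> edom g" and X: "convex X"
  shows "convex_on X (\<lambda>x. real_of_ereal (g x))"
proof (rule convex_onI)
  fix t :: real and x y
  assume t: "0 < t" "t < 1" and xy: "x \<in> X" "y \<in> X"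
  then have "x \<in> edom g" "y \<in> edom g"
    using sub by auto
  with t have "(1 - t) *\<^sub>R x + t *\<^sub>R y \<in> edom g"
    using convex_edom[OF g] by (intro convexD) auto
  from proper_closed_convex_real[OF g this]
    proper_closed_convex_segment[OF g \<open>x \<in> edom g\<close> \<open>y \<in> edom g\<close>, of "1 - t" t] t
  show "real_of_ereal (g ((1 - t) *\<^sub>R x + t *\<^sub>R y))
      \<le> (1 - t) * real_of_ereal (g x) + t * real_of_ereal (g y)"
    by (metis (no_types, lifting) add.commute diff_add_cancel diff_ge_0_iff_ge ereal_less_eq(3) less_imp_le)
qed (use X in simp)

text \<open>Every real sublevel set is a slice of the closed epigraph, hence closed.\<close>

lemma proper_closed_convex_measurable:
  assumes "proper_closed_convex g"
  shows "g \<in> borel_measurable borel"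
proof -
  have "closed {x. g x \<le> ereal a}" for a
  proof -
    have "closed ((\<lambda>x. (x, a)) -` eepigraph g)"
      using assms unfolding proper_closed_convex_def
      by (intro closed_vimage continuous_intros) auto
    then show ?thesis
      by (simp add: eepigraph_def vimage_def)
  qed
  moreover have "{x. g x \<le> -\<infinity>} = {}"
    using assms by (auto simp: proper_closed_convex_def)
  ultimately have "{x. g x \<le> a} \<in> sets borel" for a
    by (cases a) (auto intro: borel_closed)
  then show ?thesis
    by (subst borel_measurable_iff_Iic_ereal) (simp add: vimage_def)
qed

text \<open>The finite value at \<open>v\<close> forces the minimum to be finite. Thus
  \<open>x\<close> lies in \<open>edom h\<close> and the comparison can be read in the
  reals.\<close>

lemma is_arg_min_prox_step:
  assumes h: "proper_closed_convex h" and v: "v \<in> edom h"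
    and min: "is_arg_min (\<lambda>u. h u + ereal (S \<bullet> u + 1 / (2 * lam) * (norm (u - c))\<^sup>2)) (\<lambda>_. True) x"
  shows "prox_step (edom h) (\<lambda>u. real_of_ereal (h u)) lam S c x"
proof -
  let ?q = "\<lambda>u. S \<bullet> u + 1 / (2 * lam) * (norm (u - c))\<^sup>2"
  have le: "h x + ereal (?q x) \<le> h u + ereal (?q u)" for u
    using min by (auto simp: is_arg_min_def not_less)
  have "h v < \<infinity>"
    using v by (simp add: edom_def)
  with le[of v] have x: "x \<in> edom h"
    by (cases "h x"; cases "h v") (auto simp: edom_def)
  show ?thesis
    unfolding prox_step_def
  proof (intro conjI ballI)
    fix u assume u: "u \<in> edom h"
    from le[of u] show "real_of_ereal (h x) + ?q x \<le> real_of_ereal (h u) + ?q u"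
      by (subst (asm) proper_closed_convex_real[OF h x], subst (asm) proper_closed_convex_real[OF h u]) simp
  qed (rule x)
qed

section \<open>One run of the scheme, cycle by cycle\<close>

lemma SCPB_cycle:
  assumes run: "SCPB h s lam \<theta> K x0 z j S x y" and h: "proper_closed_convex h" and x0: "x0 \<in> edom h"
    and k: "k \<in> {1..K}" and t: "j (k - 1) + t < j k"
  defines "b \<equiv> j (k - 1)" and "\<tau> \<equiv> \<theta> * real K / (\<theta> * real K + 1)"
  shows "S (b + Suc t) = ema \<tau> (\<lambda>t. s (x (b + t)) (z (b + t))) t"
    and "y (b + Suc t) = ema \<tau> (\<lambda>t. x (b + Suc t)) t"
    and "prox_step (edom h) (\<lambda>u. real_of_ereal (h u)) lam (S (b + Suc t)) (x b) (x (b + Suc t))"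
proof -
  have rec: "S i = (if i = b + 1 then s (x b) (z b)
        else (1 - \<tau>) *\<^sub>R s (x (i - 1)) (z (i - 1)) + \<tau> *\<^sub>R S (i - 1))"
      "is_arg_min (\<lambda>u. h u + ereal (S i \<bullet> u + 1 / (2 * lam) * (norm (u - x b))\<^sup>2)) (\<lambda>_. True) (x i)"
      "y i = (if i = b + 1 then x i else (1 - \<tau>) *\<^sub>R x i + \<tau> *\<^sub>R y (i - 1))"
    if "i \<in> {b + 1..j k}" for i
    using run k that unfolding SCPB_def Let_def b_def \<tau>_def by blast+
  \<comment> \<open>\<open>b\<close> ends the preceding cycle, so step \<open>t\<close> of this
    cycle is iteration \<open>b + Suc t\<close>; it uses sample \<open>b + t\<close>, evaluated at
    \<open>x (b + t)\<close>. For \<open>t = 0\<close> this point is the prox-center.\<close>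
  have "S (b + Suc t) = ema \<tau> (\<lambda>t. s (x (b + t)) (z (b + t))) t \<and>
      y (b + Suc t) = ema \<tau> (\<lambda>t. x (b + Suc t)) t"
    using t
  proof (induction t)
    case 0
    then show ?case
      using rec[of "b + 1"] by (simp add: b_def)
  next
    case (Suc t)
    then show ?case
      using rec[of "b + Suc (Suc t)"] by (simp add: b_def)
  qed
  then show "S (b + Suc t) = ema \<tau> (\<lambda>t. s (x (b + t)) (z (b + t))) t"
    and "y (b + Suc t) = ema \<tau> (\<lambda>t. x (b + Suc t)) t"
    by auto
  show "prox_step (edom h) (\<lambda>u. real_of_ereal (h u)) lam (S (b + Suc t)) (x b) (x (b + Suc t))"
    using is_arg_min_prox_step[OF h x0] rec[of "b + Suc t"] t by (simp add: b_def)
qed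

lemma SCPB_cycle_start:
  assumes "SCPB h s lam \<theta> K x0 z j S x y"
  shows "j 0 = 0" "x 0 = x0" "k \<in> {1..K} \<Longrightarrow> j (k - 1) < j k"
  using assms unfolding SCPB_def Let_def by (auto simp: Suc_le_eq)

lemma SCPB1_imp_SCPB: "SCPB1 h s lam \<theta> K R x0 z j S x y \<Longrightarrow> SCPB h s lam \<theta> K x0 z j S x y"
  by (simp add: SCPB1_def)

lemma SCPB1_cycle_end_arg_min:
  assumes "SCPB1 h s lam \<theta> K R x0 z j S x y" "k \<in> {1..K}"
  shows "is_arg_min (\<lambda>l. l) (\<lambda>l. j (k - 1) + 1 \<le> l \<and>
    lam * real k * (\<theta> * real K / (\<theta> * real K + 1)) ^ (l - (j (k - 1) + 1)) \<le> R) (j k)"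
  using assms unfolding SCPB1_def Let_def by blast

text \<open>The stopping test involves only fixed parameters, the cycle number and the preceding
  cycle end, and its least solution is unique; induction over the cycles does the rest.\<close>

lemma SCPB1_cycle_ends_deterministic:
  assumes run: "SCPB1 h s lam \<theta> K R x0 z j S x y" and run': "SCPB1 h s lam \<theta> K R x0 z' j' S' x' y'"
  shows "k \<le> K \<Longrightarrow> j k = j' k"
proof (induction k)
  case 0
  then show ?case
    using SCPB_cycle_start(1)[OF SCPB1_imp_SCPB[OF run]] SCPB_cycle_start(1)[OF SCPB1_imp_SCPB[OF run']]
    by simp
next
  case (Suc k)
  have unique: "a = b" if "is_arg_min (\<lambda>l. l) Q a" "is_arg_min (\<lambda>l. l) Q b" for Q and a b :: nat
    using that unfolding is_arg_min_def by (metis nat_neq_iff)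
  have k: "Suc k \<in> {1..K}"
    using Suc by auto
  show ?case
    using SCPB1_cycle_end_arg_min[OF run k] SCPB1_cycle_end_arg_min[OF run' k] Suc
    by (simp add: unique)
qed

text \<open>The end of the cycle passes its own test, and by minimality it comes no later than the
  iteration \<open>n\<close> steps after the first one if that passes. Both ends are counted, hence
  \<open>n + 1\<close>.\<close>

lemma SCPB1_cycle_end:
  assumes run: "SCPB1 h s lam \<theta> K R x0 z j S x y" and k: "k \<in> {1..K}"
  defines "\<tau> \<equiv> \<theta> * real K / (\<theta> * real K + 1)"
  shows "lam * real k * \<tau> ^ (j k - Suc (j (k - 1))) \<le> R"
    and "lam * real k * \<tau> ^ n \<le> R \<Longrightarrow> card {j (k - 1) + 1..j k} \<le> n + 1"
proof -
  have *: "is_arg_min (\<lambda>l. l) (\<lambda>l. j (k - 1) + 1 \<le> l \<and> lam * real k * \<tau> ^ (l - (j (k - 1) + 1)) \<le> R) (j k)"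
    using SCPB1_cycle_end_arg_min[OF run k] by (simp add: \<tau>_def)
  then show "lam * real k * \<tau> ^ (j k - Suc (j (k - 1))) \<le> R"
    by (auto simp: is_arg_min_def)
  assume "lam * real k * \<tau> ^ n \<le> R"
  with * have "j k \<le> j (k - 1) + 1 + n"
    by (auto simp: is_arg_min_def not_less dest!: spec[of _ "j (k - 1) + 1 + n"])
  then show "card {j (k - 1) + 1..j k} \<le> n + 1"
    by simp
qed

section \<open>Iteration counts\<close>

lemma geometric_below_one:
  fixes C q :: real
  assumes C: "C > 0" and q: "q > 0"
  shows "q * (C / (C + 1)) ^ nat \<lceil>(C + 1) * ln0p q\<rceil> \<le> 1"
proof -
  let ?n = "nat \<lceil>(C + 1) * ln0p q\<rceil>"
  have "(C + 1) * ln q \<le> (C + 1) * ln0p q"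
    using C by (simp add: ln0p_def)
  also have "\<dots> \<le> real ?n"
    by linarith
  finally have "ln q \<le> real ?n * (1 / (C + 1))"
    using C by (simp add: field_simps)
  \<comment> \<open>Each factor \<open>C / (C + 1)\<close> lowers the logarithm by at least
    \<open>1 / (C + 1)\<close>, so \<open>(C + 1) * ln q\<close> factors suffice.\<close>
  moreover have "ln (C / (C + 1)) \<le> C / (C + 1) - 1"
    using C by (intro ln_le_minus_one) simp
  then have "real ?n * ln (C / (C + 1)) \<le> real ?n * (- (1 / (C + 1)))"
    using C by (intro mult_left_mono) (auto simp: field_simps)
  ultimately have "ln (q * (C / (C + 1)) ^ ?n) \<le> 0"
    using C q by (simp add: ln_mult ln_realpow)
  then show ?thesis
    using C q by (subst (asm) ln_le_zero_iff) auto
qed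

lemma cycle_length_bounds:
  assumes C: "C \<ge> 1" and D: "D > 0" and M: "M > 0"
    and run: "SCPB1 h s (sqrt C * D / (M * sqrt (real K))) (C / real K) K (D / M) x0 z j S x y"
    and k: "k \<in> {1..K}"
  defines "q \<equiv> sqrt C * real k / sqrt (real K)"
  shows "int (card {j (k - 1) + 1..j k}) \<le> \<lceil>(C + 1) * ln0p q\<rceil> + 1"
    and "real (card {j (k - 1) + 1..j k}) \<le> 2 * (C * (1 + ln0p q))"
proof -
  let ?n = "nat \<lceil>(C + 1) * ln0p q\<rceil>"
  have K: "real K > 0" "real k > 0"
    using k by auto
  have q: "q > 0"
    using C K by (simp add: q_def)
  \<comment> \<open>The choice of \<open>\<theta>\<close> makes \<open>\<theta> * K = C\<close>;
    with \<open>lam\<close> and \<open>R\<close> as chosen, the stopping test turns into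
    \<open>q * \<tau> ^ n <= 1\<close>.\<close>
  have \<tau>: "C / real K * real K / (C / real K * real K + 1) = C / (C + 1)"
    using K by simp
  have "sqrt C * D / (M * sqrt (real K)) * real k * (C / (C + 1)) ^ ?n = D / M * (q * (C / (C + 1)) ^ ?n)"
    by (simp add: q_def)
  also have "\<dots> \<le> D / M * 1"
    using geometric_below_one[OF _ q] C D M by (intro mult_left_mono) auto
  finally have "card {j (k - 1) + 1..j k} \<le> ?n + 1"
    using SCPB1_cycle_end(2)[OF run k, of ?n] \<tau> by simp
  moreover have "ln0p q \<ge> 0"
    by (simp add: ln0p_def)
  moreover from this have "0 \<le> (C + 1) * ln0p q"
    using C by simp
  moreover from this have "int ?n = \<lceil>(C + 1) * ln0p q\<rceil>"
    by simp
  ultimately show *: "int (card {j (k - 1) + 1..j k}) \<le> \<lceil>(C + 1) * ln0p q\<rceil> + 1"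
    by linarith
  \<comment> \<open>Since \<open>C >= 1\<close>, both \<open>C + 1\<close> and the additive 2 (one
    from the ceiling, one from the count) are at most \<open>2 * C\<close>.\<close>
  have "(C + 1) * ln0p q \<le> 2 * C * ln0p q"
    using C \<open>ln0p q \<ge> 0\<close> by (intro mult_right_mono) auto
  moreover have "real (card {j (k - 1) + 1..j k}) \<le> (C + 1) * ln0p q + 2"
    using * by linarith
  ultimately show "real (card {j (k - 1) + 1..j k}) \<le> 2 * (C * (1 + ln0p q))"
    using C by (simp add: algebra_simps)
qed

text \<open>The logarithmic factor grows with \<open>k\<close>, so that of the last cycle, where
  \<open>sqrt C * K / sqrt K = sqrt (C * K)\<close>, bounds all.\<close>

lemma total_length_bound:
  assumes C: "C \<ge> 1" and D: "D > 0" and M: "M > 0"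
    and run: "SCPB1 h s (sqrt C * D / (M * sqrt (real K))) (C / real K) K (D / M) x0 z j S x y"
  shows "real (\<Sum>k = 1..K. card {j (k - 1) + 1..j k}) \<le> 2 * (C * real K * (1 + ln0p (sqrt (C * real K))))"
proof -
  have "real (card {j (k - 1) + 1..j k}) \<le> 2 * (C * (1 + ln0p (sqrt (C * real K))))" if k: "k \<in> {1..K}" for k
  proof -
    have K: "real K > 0" "real k \<le> real K" "real k > 0"
      using k by auto
    have "sqrt C * real k / sqrt (real K) \<le> sqrt C * real K / sqrt (real K)"
      using K C by (intro divide_right_mono mult_left_mono) auto
    also have "\<dots> = sqrt (C * real K)"
      using K by (simp add: real_sqrt_mult real_div_sqrt flip: times_divide_eq_right)
    finally have "ln0p (sqrt C * real k / sqrt (real K)) \<le> ln0p (sqrt (C * real K))"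
      unfolding ln0p_def using K C by (intro max.mono ln_mono) auto
    with cycle_length_bounds(2)[OF C D M run k] show ?thesis
      using C by (smt (verit) mult_left_mono)
  qed
  from sum_mono[of "{1..K}", OF this] show ?thesis
    by (simp add: algebra_simps)
qed

section \<open>Freezing the past\<close>

text \<open>
  Makes the proximal point a random vector without proving that the proximal map is defined everywhere:
  \<open>X\<close> factors through \<open>W\<close> by a nonexpansive map on the range of \<open>W\<close>.
\<close>

lemma borel_measurable_dominated_oscillation:
  fixes X :: "'w \<Rightarrow> 'a::metric_space" and W :: "'w \<Rightarrow> 'b::metric_space"
  assumes W: "W \<in> borel_measurable N"
    and osc: "\<And>\<omega> \<omega>'. \<omega> \<in> space N \<Longrightarrow> \<omega>' \<in> space N \<Longrightarrow> dist (X \<omega>) (X \<omega>') \<le> dist (W \<omega>) (W \<omega>')"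
  shows "X \<in> borel_measurable N"
proof -
  define V where "V = W ` space N"
  \<comment> \<open>\<open>r\<close> selects an outcome for each value of \<open>W\<close>; the
    choice does not affect \<open>X\<close>, because equal values of \<open>W\<close> force equal
    values of \<open>X\<close>.\<close>
  define r where "r v = (SOME \<omega>. \<omega> \<in> space N \<and> W \<omega> = v)" for v
  have "\<exists>\<omega>. \<omega> \<in> space N \<and> W \<omega> = v" if "v \<in> V" for v
    using that by (auto simp: V_def)
  then have r: "r v \<in> space N \<and> W (r v) = v" if "v \<in> V" for v
    unfolding r_def using that by (metis (mono_tags, lifting) someI_ex)
  define g where "g v = X (r v)" for v
  have "dist (g v) (g w) \<le> dist v w" if "v \<in> V" "w \<in> V" for v w
    using osc[of "r v" "r w"] r[of v] r[of w] that by (simp add: g_def)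
  then have "1-lipschitz_on V g"
    by (intro lipschitz_onI) auto
  then have g: "g \<in> borel_measurable (restrict_space borel V)"
    by (intro borel_measurable_continuous_on_restrict lipschitz_on_continuous_on)
  have "W \<in> measurable N (restrict_space borel V)"
    using W by (intro measurable_restrict_space2) (auto simp: V_def)
  from measurable_compose[OF this g] have "(\<lambda>\<omega>. g (W \<omega>)) \<in> borel_measurable N" .
  moreover have "g (W \<omega>) = X \<omega>" if "\<omega> \<in> space N" for \<omega>
    using osc[of "r (W \<omega>)" \<omega>] r[of "W \<omega>"] that
    by (simp add: g_def V_def)
  ultimately show ?thesis
    by (simp cong: measurable_cong)
qed

section \<open>Independent samples and their natural filtration\<close>

context prob_space
begin

lemma expectation_square_le:
  fixes X :: "'a \<Rightarrow> real"
  assumes "X \<in> borel_measurable M" and sq: "integrable M (\<lambda>\<omega>. (X \<omega>)\<^sup>2)"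
  shows "integrable M X" and "(expectation X)\<^sup>2 \<le> expectation (\<lambda>\<omega>. (X \<omega>)\<^sup>2)"
proof -
  show "integrable M X"
    using assms by (rule square_integrable_imp_integrable)
  then have "variance X = expectation (\<lambda>\<omega>. (X \<omega>)\<^sup>2) - (expectation X)\<^sup>2"
    using sq by (rule variance_eq)
  then show "(expectation X)\<^sup>2 \<le> expectation (\<lambda>\<omega>. (X \<omega>)\<^sup>2)"
    using variance_positive[of X] by simp
qed

text \<open>Fubini for the product law of \<open>X\<close> and \<open>Z\<close>: the value
  \<open>p\<close> of \<open>X\<close> is frozen, the bound holds for each \<open>p\<close>, and it
  survives integration over the law of \<open>X\<close>.\<close>

lemma expectation_indep_var_le:
  fixes G :: "'b \<Rightarrow> 'c \<Rightarrow> real"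
  assumes X [measurable]: "X \<in> measurable M A" and Z [measurable]: "Z \<in> measurable M B"
    and prod: "distr M A X \<Otimes>\<^sub>M distr M B Z = distr M (A \<Otimes>\<^sub>M B) (\<lambda>\<omega>. (X \<omega>, Z \<omega>))"
    and G: "(\<lambda>(p, z). G p z) \<in> borel_measurable (A \<Otimes>\<^sub>M B)"
    and int: "integrable M (\<lambda>\<omega>. G (X \<omega>) (Z \<omega>))"
    and le: "\<And>p. p \<in> space A \<Longrightarrow> expectation (\<lambda>\<omega>. G p (Z \<omega>)) \<le> c"
  shows "expectation (\<lambda>\<omega>. G (X \<omega>) (Z \<omega>)) \<le> c"
proof -
  note G [measurable]
  interpret X: prob_space "distr M A X"
    by (rule prob_space_distr) measurable
  interpret Z: prob_space "distr M B Z"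
    by (rule prob_space_distr) measurable
  interpret XZ: pair_sigma_finite "distr M A X" "distr M B Z" ..
  have int': "integrable (distr M A X \<Otimes>\<^sub>M distr M B Z) (\<lambda>(p, z). G p z)"
    unfolding prod using int by (subst integrable_distr_eq) auto
  have "expectation (\<lambda>\<omega>. G (X \<omega>) (Z \<omega>)) = (\<integral>w. (\<lambda>(p, z). G p z) w \<partial>(distr M A X \<Otimes>\<^sub>M distr M B Z))"
    unfolding prod by (subst integral_distr) auto
  also have "\<dots> = (\<integral>p. (\<integral>z. G p z \<partial>distr M B Z) \<partial>distr M A X)"
    using XZ.integral_fst'[OF int'] by simp
  also have "\<dots> \<le> c"
  proof (rule X.integral_le_const)
    show "integrable (distr M A X) (\<lambda>p. \<integral>z. G p z \<partial>distr M B Z)"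
      using XZ.integrable_fst'[OF int'] by simp
    have "(\<integral>z. G p z \<partial>distr M B Z) \<le> c" if p: "p \<in> space A" for p
    proof -
      have "G p \<in> borel_measurable B"
        using measurable_compose[OF measurable_Pair1'[OF p] G] by simp
      then show ?thesis
        using le[OF p] by (subst integral_distr) auto
    qed
    then show "AE p in distr M A X. (\<integral>z. G p z \<partial>distr M B Z) \<le> c"
      by (intro AE_I2) simp
  qed
  finally show ?thesis .
qed

text \<open>For nonnegative \<open>G\<close> the inner integrals are bounded by \<open>c\<close>,
  hence integrable over the law of \<open>X\<close>; by Tonelli this gives integrability on the
  product.\<close>

lemma integrable_indep_var_nonneg:
  fixes G :: "'b \<Rightarrow> 'c \<Rightarrow> real"
  assumes X [measurable]: "X \<in> measurable M A" and Z [measurable]: "Z \<in> measurable M B"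
    and prod: "distr M A X \<Otimes>\<^sub>M distr M B Z = distr M (A \<Otimes>\<^sub>M B) (\<lambda>\<omega>. (X \<omega>, Z \<omega>))"
    and G: "(\<lambda>(p, z). G p z) \<in> borel_measurable (A \<Otimes>\<^sub>M B)"
    and nonneg: "\<And>p z. 0 \<le> G p z"
    and int: "\<And>p. p \<in> space A \<Longrightarrow> integrable M (\<lambda>\<omega>. G p (Z \<omega>))"
    and le: "\<And>p. p \<in> space A \<Longrightarrow> expectation (\<lambda>\<omega>. G p (Z \<omega>)) \<le> c"
  shows "integrable M (\<lambda>\<omega>. G (X \<omega>) (Z \<omega>))"
proof -
  note G [measurable]
  interpret X: prob_space "distr M A X"
    by (rule prob_space_distr) measurable
  interpret Z: prob_space "distr M B Z"
    by (rule prob_space_distr) measurable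
  interpret XZ: pair_sigma_finite "distr M A X" "distr M B Z" ..
  have Gp: "G p \<in> borel_measurable B" if p: "p \<in> space A" for p
    using measurable_compose[OF measurable_Pair1'[OF p] G] by simp
  have bound: "(\<integral>z. G p z \<partial>distr M B Z) \<le> c" if p: "p \<in> space A" for p
    using le[OF p] Gp[OF p] by (subst integral_distr) auto
  have "integrable (distr M A X) (\<lambda>p. \<integral>z. G p z \<partial>distr M B Z)"
    using bound nonneg by (intro X.integrable_const_bound[of _ c] AE_I2) auto
  moreover have "integrable (distr M B Z) (\<lambda>z. G p z)" if "p \<in> space A" for p
    using int[OF that] Gp[OF that] by (subst integrable_distr_eq) auto
  ultimately have "integrable (distr M A X \<Otimes>\<^sub>M distr M B Z) (\<lambda>(p, z). G p z)"
    using nonneg by (intro XZ.Fubini_integrable) (auto intro!: AE_I2)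
  then show ?thesis
    unfolding prod by (subst (asm) integrable_distr_eq) auto
qed

text \<open>The sigma-algebra generated by the samples before index \<open>i\<close>. As a pullback
  along the finite family of these samples, each of its events is the preimage of a
  product-measurable set.\<close>

definition past :: "(nat \<Rightarrow> 'a \<Rightarrow> 'b::topological_space) \<Rightarrow> nat \<Rightarrow> 'a measure" where
  "past \<zeta> i = vimage_algebra (space M) (\<lambda>\<omega>. \<lambda>m\<in>{..<i}. \<zeta> m \<omega>) (Pi\<^sub>M {..<i} (\<lambda>_. borel))"

lemma space_past [simp]: "space (past \<zeta> i) = space M"
  by (simp add: past_def)

lemma past_sample:
  assumes "m < i"
  shows "\<zeta> m \<in> borel_measurable (past \<zeta> i)"
proof -
  have "(\<lambda>\<omega>. \<lambda>m\<in>{..<i}. \<zeta> m \<omega>) \<in> measurable (past \<zeta> i) (Pi\<^sub>M {..<i} (\<lambda>_. borel))"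
    unfolding past_def by (rule measurable_vimage_algebra1) (auto simp: space_PiM)
  from measurable_compose[OF this measurable_component_singleton[of m]] assms show ?thesis
    by simp
qed

lemma measurable_past_mono:
  assumes X: "X \<in> measurable (past \<zeta> i) A" and "i \<le> i'"
  shows "X \<in> measurable (past \<zeta> i') A"
proof -
  have "(\<lambda>\<omega>. \<lambda>m\<in>{..<i}. \<zeta> m \<omega>) \<in> measurable (past \<zeta> i') (Pi\<^sub>M {..<i} (\<lambda>_. borel))"
    using assms(2) by (intro measurable_restrict past_sample) auto
  then have "(\<lambda>\<omega>. \<omega>) \<in> measurable (past \<zeta> i') (past \<zeta> i)"
    unfolding past_def[of \<zeta> i] by (intro measurable_vimage_algebra2) auto
  from measurable_compose[OF this X] show ?thesis .
qed

lemma past_subalgebra: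
  assumes "X \<in> measurable (past \<zeta> i) A" and \<zeta>: "\<And>i. \<zeta> i \<in> borel_measurable M"
  shows "X \<in> measurable M A"
proof -
  have "(\<lambda>\<omega>. \<omega>) \<in> measurable M (past \<zeta> i)"
    unfolding past_def using \<zeta> by (intro measurable_vimage_algebra2 measurable_restrict) auto
  from measurable_compose[OF this assms(1)] show ?thesis .
qed

text \<open>Each event of \<open>X\<close> is an event of the family of samples below
  \<open>i\<close>, which is independent of sample \<open>i\<close>. Rectangles then determine the
  joint law.\<close>

lemma distr_past_sample:
  fixes \<zeta> :: "nat \<Rightarrow> 'a \<Rightarrow> 'b::topological_space"
  assumes ind: "indep_vars (\<lambda>_. borel) \<zeta> UNIV" and X: "X \<in> measurable (past \<zeta> i) A"
  shows "distr M A X \<Otimes>\<^sub>M distr M borel (\<zeta> i) = distr M (A \<Otimes>\<^sub>M borel) (\<lambda>\<omega>. (X \<omega>, \<zeta> i \<omega>))"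
proof -
  have \<zeta>: "\<zeta> m \<in> borel_measurable M" for m
    using ind by (auto simp: indep_vars_def)
  have XM: "X \<in> measurable M A"
    using X \<zeta> by (rule past_subalgebra)
  interpret X: prob_space "distr M A X"
    using XM by (rule prob_space_distr)
  interpret Z: prob_space "distr M borel (\<zeta> i)"
    using \<zeta> by (rule prob_space_distr)
  let ?Y = "\<lambda>\<omega>. \<lambda>m\<in>{..<i}. \<zeta> m \<omega>" and ?Z = "\<lambda>\<omega>. \<lambda>m\<in>{i}. \<zeta> m \<omega>"
  have YZ: "indep_var (Pi\<^sub>M {..<i} (\<lambda>_. borel)) ?Y (Pi\<^sub>M {i} (\<lambda>_. borel)) ?Z"
    by (rule indep_var_restrict[OF ind]) auto
  show ?thesis
  proof (rule pair_measure_eqI)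
    fix a b
    assume "a \<in> sets (distr M A X)" "b \<in> sets (distr M borel (\<zeta> i))"
    then have a: "a \<in> sets A" and b: "b \<in> sets borel"
      by auto
    have "X -` a \<inter> space M \<in> sets (past \<zeta> i)"
      using measurable_sets[OF X a] by simp
    moreover have "sets (past \<zeta> i) = {?Y -` B \<inter> space M |B. B \<in> sets (Pi\<^sub>M {..<i} (\<lambda>_. borel))}"
      unfolding past_def by (rule sets_vimage_algebra2) (auto simp: space_PiM)
    ultimately obtain a' where a': "a' \<in> sets (Pi\<^sub>M {..<i} (\<lambda>_. borel))"
      "X -` a \<inter> space M = ?Y -` a' \<inter> space M"
      by auto
    \<comment> \<open>Sample \<open>i\<close> appears as a family over the singleton index set, so
      \<open>b\<close> is lifted to families whose entry at \<open>i\<close> lies in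
      \<open>b\<close>.\<close>
    let ?b' = "(\<lambda>w. w i) -` b \<inter> space (Pi\<^sub>M {i} (\<lambda>_. borel :: 'b measure))"
    have b': "?b' \<in> sets (Pi\<^sub>M {i} (\<lambda>_. borel))"
      using b by (intro measurable_sets[OF measurable_component_singleton]) auto
    have Zb: "?Z -` ?b' \<inter> space M = \<zeta> i -` b \<inter> space M"
      by (auto simp: space_PiM)
    have "(\<lambda>\<omega>. (?Y \<omega>, ?Z \<omega>)) -` (a' \<times> ?b') \<inter> space M = (?Y -` a' \<inter> space M) \<inter> (?Z -` ?b' \<inter> space M)"
      by auto
    also have "\<dots> = (\<lambda>\<omega>. (X \<omega>, \<zeta> i \<omega>)) -` (a \<times> b) \<inter> space M"
      unfolding Zb a'(2)[symmetric] by auto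
    finally have "prob ((\<lambda>\<omega>. (X \<omega>, \<zeta> i \<omega>)) -` (a \<times> b) \<inter> space M)
        = prob (X -` a \<inter> space M) * prob (\<zeta> i -` b \<inter> space M)"
      using indep_varD[OF YZ a'(1) b'] by (simp only: Zb a'(2))
    moreover have "a \<times> b \<in> sets (A \<Otimes>\<^sub>M borel)" "(\<lambda>\<omega>. (X \<omega>, \<zeta> i \<omega>)) \<in> measurable M (A \<Otimes>\<^sub>M borel)"
      using a b XM \<zeta> by auto
    ultimately show "emeasure (distr M A X) a * emeasure (distr M borel (\<zeta> i)) b
        = emeasure (distr M (A \<Otimes>\<^sub>M borel) (\<lambda>\<omega>. (X \<omega>, \<zeta> i \<omega>))) (a \<times> b)"
      using a b XM \<zeta> by (simp add: emeasure_distr emeasure_eq_measure ennreal_mult)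
  qed (auto intro: X.sigma_finite_measure_axioms Z.sigma_finite_measure_axioms cong: sets_pair_measure_cong)
qed

end

section \<open>The stochastic oracle at past-measurable points\<close>

locale stochastic_composite = prob_space P
  for P :: "'w measure" +
  fixes \<xi> :: "'w \<Rightarrow> 'b::euclidean_space"
    and \<zeta> :: "nat \<Rightarrow> 'w \<Rightarrow> 'b"
    and f h :: "'a::euclidean_space \<Rightarrow> ereal"
    and F :: "'a \<Rightarrow> 'b \<Rightarrow> real"
    and s :: "'a \<Rightarrow> 'b \<Rightarrow> 'a"
  assumes xi [measurable]: "\<xi> \<in> borel_measurable P"
    and samples_indep: "indep_vars (\<lambda>_. borel) \<zeta> UNIV"
    and samples_law: "\<And>i. distr P borel (\<zeta> i) = distr P borel \<xi>"
    and f: "proper_closed_convex f" and h: "proper_closed_convex h"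
    and edom_subset: "edom h \<subseteq> edom f"
    and oracles: "stochastic_oracles P \<xi> f h F s"
    and rms: "finite_oracle_bound P \<xi> h s"
    and bounded_edom: "bounded (edom h)"
begin

abbreviation X :: "'a set" where "X \<equiv> edom h"
abbreviation fr :: "'a \<Rightarrow> real" where "fr v \<equiv> real_of_ereal (f v)"
abbreviation hr :: "'a \<Rightarrow> real" where "hr v \<equiv> real_of_ereal (h v)"
abbreviation B :: real where "B \<equiv> oracle_bound P \<xi> h s"
abbreviation d :: real where "d \<equiv> diameter (edom h)"

lemma sample_measurable [measurable]: "\<zeta> i \<in> borel_measurable P"
  using samples_indep by (auto simp: indep_vars_def)

lemma oracle_measurable [measurable]:
  "(\<lambda>(p, z). s p z) \<in> borel_measurable (restrict_space borel X \<Otimes>\<^sub>M borel)"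
  using oracles by (auto simp: stochastic_oracles_def)

lemma oracle_measurable_at: "p \<in> X \<Longrightarrow> s p \<in> borel_measurable borel"
  using measurable_compose[OF measurable_Pair1' oracle_measurable, of p] by (simp add: space_restrict_space)

lemma sample_integrable_iff:
  fixes g :: "'b \<Rightarrow> 'c::{banach, second_countable_topology}"
  assumes "g \<in> borel_measurable borel"
  shows "integrable P (\<lambda>\<omega>. g (\<zeta> i \<omega>)) \<longleftrightarrow> integrable P (\<lambda>\<omega>. g (\<xi> \<omega>))"
  using assms integrable_distr_eq[of "\<zeta> i" P borel g] integrable_distr_eq[of \<xi> P borel g]
  by (simp add: samples_law)

lemma sample_expectation:
  fixes g :: "'b \<Rightarrow> 'c::{banach, second_countable_topology}"
  assumes "g \<in> borel_measurable borel"
  shows "expectation (\<lambda>\<omega>. g (\<zeta> i \<omega>)) = expectation (\<lambda>\<omega>. g (\<xi> \<omega>))"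
  using assms integral_distr[of "\<zeta> i" P borel g] integral_distr[of \<xi> P borel g]
  by (simp add: samples_law)

lemma norm_diff_le_diameter: "v \<in> X \<Longrightarrow> w \<in> X \<Longrightarrow> norm (v - w) \<le> d"
  using diameter_bounded_bound[OF bounded_edom] by (simp add: dist_norm)

lemma edom_nonempty: "X \<noteq> {}"
  using h by (simp add: proper_closed_convex_def)

lemma oracle_rms_le: "p \<in> X \<Longrightarrow> oracle_rms P \<xi> s p \<le> B"
  using rms unfolding oracle_bound_def finite_oracle_bound_def by (auto intro: cSUP_upper)

lemma B_nonneg: "B \<ge> 0"
proof -
  obtain p where p: "p \<in> X"
    using edom_nonempty by blast
  have "0 \<le> oracle_rms P \<xi> s p"
    by (simp add: oracle_rms_def)
  with oracle_rms_le[OF p] show ?thesis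
    by simp
qed

lemma oracle_second_moment:
  assumes "p \<in> X"
  shows "integrable P (\<lambda>\<omega>. (norm (s p (\<zeta> i \<omega>)))\<^sup>2)"
    and "expectation (\<lambda>\<omega>. (norm (s p (\<zeta> i \<omega>)))\<^sup>2) \<le> B\<^sup>2"
proof -
  note [measurable] = oracle_measurable_at[OF assms]
  have m: "(\<lambda>z. (norm (s p z))\<^sup>2) \<in> borel_measurable borel"
    by measurable
  show "integrable P (\<lambda>\<omega>. (norm (s p (\<zeta> i \<omega>)))\<^sup>2)"
    using rms assms sample_integrable_iff[OF m] by (auto simp: finite_oracle_bound_def)
  have "sqrt (expectation (\<lambda>\<omega>. (norm (s p (\<xi> \<omega>)))\<^sup>2)) \<le> B"
    using oracle_rms_le[OF assms] by (simp add: oracle_rms_def)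
  then show "expectation (\<lambda>\<omega>. (norm (s p (\<zeta> i \<omega>)))\<^sup>2) \<le> B\<^sup>2"
    using sample_expectation[OF m] by (metis sqrt_le_D)
qed

lemma oracle_first_moment:
  assumes "p \<in> X"
  shows "integrable P (\<lambda>\<omega>. norm (s p (\<zeta> i \<omega>)))"
    and "expectation (\<lambda>\<omega>. norm (s p (\<zeta> i \<omega>))) \<le> B"
proof -
  note [measurable] = oracle_measurable_at[OF assms]
  have m: "(\<lambda>\<omega>. norm (s p (\<zeta> i \<omega>))) \<in> borel_measurable P"
    by measurable
  note sq = expectation_square_le[OF m oracle_second_moment(1)[OF assms]]
  show "integrable P (\<lambda>\<omega>. norm (s p (\<zeta> i \<omega>)))"
    by (rule sq)
  show "expectation (\<lambda>\<omega>. norm (s p (\<zeta> i \<omega>))) \<le> B"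
    using order_trans[OF sq(2) oracle_second_moment(2)[OF assms]] B_nonneg by (rule power2_le_imp_le)
qed

lemma oracle_mean:
  assumes p: "p \<in> X"
  shows "integrable P (\<lambda>\<omega>. s p (\<zeta> i \<omega>))"
    and "norm (expectation (\<lambda>\<omega>. s p (\<zeta> i \<omega>))) \<le> B"
    and "u \<in> X \<Longrightarrow> fr p + expectation (\<lambda>\<omega>. s p (\<zeta> i \<omega>)) \<bullet> (u - p) \<le> fr u"
proof -
  note m = oracle_measurable_at[OF p]
  have "integrable P (\<lambda>\<omega>. s p (\<xi> \<omega>))" and sub: "expectation (\<lambda>\<omega>. s p (\<zeta> i \<omega>)) \<in> subdifferential f p"
    using oracles p by (auto simp: stochastic_oracles_def sample_expectation[OF m])
  then show int: "integrable P (\<lambda>\<omega>. s p (\<zeta> i \<omega>))"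
    by (simp add: sample_integrable_iff[OF m])
  show "norm (expectation (\<lambda>\<omega>. s p (\<zeta> i \<omega>))) \<le> B"
    using integral_norm_bound[of P "\<lambda>\<omega>. s p (\<zeta> i \<omega>)"] oracle_first_moment(2)[OF p, of i] by linarith
  assume u: "u \<in> X"
  have "f p + ereal (expectation (\<lambda>\<omega>. s p (\<zeta> i \<omega>)) \<bullet> (u - p)) \<le> f u"
    using sub by (simp add: subdifferential_def)
  moreover have "f p = ereal (fr p)" "f u = ereal (fr u)"
    using proper_closed_convex_real[OF f] p u edom_subset by blast+
  ultimately show "fr p + expectation (\<lambda>\<omega>. s p (\<zeta> i \<omega>)) \<bullet> (u - p) \<le> fr u"
    by (metis ereal_less_eq(3) plus_ereal.simps(1))
qed

text \<open>The mean oracle at \<open>v\<close> is a subgradient whose norm is at most the mean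
  norm, hence at most \<open>B\<close>. All samples have the same law, and sample 0 stands for any
  of them.\<close>

lemma f_lipschitz:
  assumes "v \<in> X" "w \<in> X"
  shows "fr v - fr w \<le> B * norm (v - w)"
proof -
  let ?g = "expectation (\<lambda>\<omega>. s v (\<zeta> 0 \<omega>))"
  have "fr v - fr w \<le> - (?g \<bullet> (w - v))"
    using oracle_mean(3)[OF assms, of 0] by simp
  also have "\<dots> \<le> norm ?g * norm (v - w)"
    using norm_cauchy_schwarz[of ?g "v - w"] by (simp add: inner_diff_right)
  also have "\<dots> \<le> B * norm (v - w)"
    using oracle_mean(2)[OF assms(1)] by (intro mult_right_mono) auto
  finally show ?thesis .
qed

lemma fr_measurable [measurable]: "fr \<in> borel_measurable borel"
  and hr_measurable [measurable]: "hr \<in> borel_measurable borel"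
  using proper_closed_convex_measurable[OF f] proper_closed_convex_measurable[OF h] by simp_all

lemma convex_X: "convex X"
  and convex_fr: "convex_on X fr"
  and convex_hr: "convex_on X hr"
  using convex_edom[OF h] convex_on_edom[OF f edom_subset] convex_on_edom[OF h order_refl] by auto

section \<open>Oracle calls at a random point determined by earlier samples\<close>

context
  fixes V :: "'w \<Rightarrow> 'a" and i :: nat
  assumes V: "V \<in> measurable (past \<zeta> i) (restrict_space borel X)"
begin

lemma V_measurable: "V \<in> measurable P (restrict_space borel X)"
  using V sample_measurable by (rule past_subalgebra)

lemma V_borel [measurable]: "V \<in> borel_measurable P"
  using V_measurable by (simp add: measurable_restrict_space2_iff)

lemma V_in_X: "\<omega> \<in> space P \<Longrightarrow> V \<omega> \<in> X"
  using measurable_space[OF V_measurable] by (simp add: space_restrict_space)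

lemma V_oracle_measurable [measurable]: "(\<lambda>\<omega>. s (V \<omega>) (\<zeta> i \<omega>)) \<in> borel_measurable P"
  using measurable_compose[OF measurable_Pair[OF V_measurable sample_measurable] oracle_measurable] by simp

lemmas expectation_V_le = expectation_indep_var_le[OF V_measurable sample_measurable
    distr_past_sample[OF samples_indep V]]
  and integrable_V = integrable_indep_var_nonneg[OF V_measurable sample_measurable
    distr_past_sample[OF samples_indep V]]

lemma V_second_moment:
  "integrable P (\<lambda>\<omega>. (norm (s (V \<omega>) (\<zeta> i \<omega>)))\<^sup>2)"
  "expectation (\<lambda>\<omega>. (norm (s (V \<omega>) (\<zeta> i \<omega>)))\<^sup>2) \<le> B\<^sup>2"
proof -
  have m: "(\<lambda>(p, z). (norm (s p z))\<^sup>2) \<in> borel_measurable (restrict_space borel X \<Otimes>\<^sub>M borel)"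
    by measurable
  show int: "integrable P (\<lambda>\<omega>. (norm (s (V \<omega>) (\<zeta> i \<omega>)))\<^sup>2)"
    using oracle_second_moment by (intro integrable_V[OF m]) (auto simp: space_restrict_space)
  show "expectation (\<lambda>\<omega>. (norm (s (V \<omega>) (\<zeta> i \<omega>)))\<^sup>2) \<le> B\<^sup>2"
    using oracle_second_moment by (intro expectation_V_le[OF m int]) (auto simp: space_restrict_space)
qed

lemma V_first_moment:
  "integrable P (\<lambda>\<omega>. norm (s (V \<omega>) (\<zeta> i \<omega>)))"
  "expectation (\<lambda>\<omega>. norm (s (V \<omega>) (\<zeta> i \<omega>))) \<le> B"
proof -
  have m: "(\<lambda>(p, z). norm (s p z)) \<in> borel_measurable (restrict_space borel X \<Otimes>\<^sub>M borel)"
    by measurable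
  show int: "integrable P (\<lambda>\<omega>. norm (s (V \<omega>) (\<zeta> i \<omega>)))"
    using oracle_first_moment by (intro integrable_V[OF m]) (auto simp: space_restrict_space)
  show "expectation (\<lambda>\<omega>. norm (s (V \<omega>) (\<zeta> i \<omega>))) \<le> B"
    using oracle_first_moment by (intro expectation_V_le[OF m int]) (auto simp: space_restrict_space)
qed

text \<open>Since \<open>V\<close> depends on earlier samples only, it can be frozen at a point
  \<open>p\<close>, where the mean of the oracle is a subgradient. Integrability rests on the
  bounded domain, on which \<open>fr\<close> is bounded too.\<close>

lemma V_linearization:
  assumes u: "u \<in> X"
  shows "integrable P (\<lambda>\<omega>. fr (V \<omega>) + s (V \<omega>) (\<zeta> i \<omega>) \<bullet> (u - V \<omega>))"
    and "expectation (\<lambda>\<omega>. fr (V \<omega>) + s (V \<omega>) (\<zeta> i \<omega>) \<bullet> (u - V \<omega>)) \<le> fr u"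
proof -
  have "integrable P (\<lambda>\<omega>. fr (V \<omega>))"
  proof (rule integrable_const_bound)
    have "\<bar>fr v\<bar> \<le> \<bar>fr u\<bar> + B * d" if "v \<in> X" for v
      using f_lipschitz[OF that u] f_lipschitz[OF u that]
        mult_left_mono[OF norm_diff_le_diameter[OF that u] B_nonneg]
      unfolding norm_minus_commute[of u v] by linarith
    then show "AE \<omega> in P. norm (fr (V \<omega>)) \<le> \<bar>fr u\<bar> + B * d"
      using V_in_X by auto
  qed measurable
  moreover have "integrable P (\<lambda>\<omega>. s (V \<omega>) (\<zeta> i \<omega>) \<bullet> (u - V \<omega>))"
  proof (rule Bochner_Integration.integrable_bound)
    show "integrable P (\<lambda>\<omega>. norm (s (V \<omega>) (\<zeta> i \<omega>)) * d)"
      using V_first_moment(1) by simp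
    have "norm (s (V \<omega>) (\<zeta> i \<omega>) \<bullet> (u - V \<omega>)) \<le> norm (norm (s (V \<omega>) (\<zeta> i \<omega>)) * d)" if "\<omega> \<in> space P" for \<omega>
    proof -
      have "norm (s (V \<omega>) (\<zeta> i \<omega>) \<bullet> (u - V \<omega>)) \<le> norm (s (V \<omega>) (\<zeta> i \<omega>)) * norm (u - V \<omega>)"
        using Cauchy_Schwarz_ineq2 by simp
      also have "\<dots> \<le> norm (s (V \<omega>) (\<zeta> i \<omega>)) * d"
        using norm_diff_le_diameter[OF u V_in_X[OF that]] by (intro mult_left_mono) auto
      finally show ?thesis
        by simp
    qed
    then show "AE \<omega> in P. norm (s (V \<omega>) (\<zeta> i \<omega>) \<bullet> (u - V \<omega>)) \<le> norm (norm (s (V \<omega>) (\<zeta> i \<omega>)) * d)"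
      by (rule AE_I2)
  qed measurable
  ultimately show int: "integrable P (\<lambda>\<omega>. fr (V \<omega>) + s (V \<omega>) (\<zeta> i \<omega>) \<bullet> (u - V \<omega>))"
    by (rule Bochner_Integration.integrable_add)
  have [measurable]: "(\<lambda>w. w) \<in> measurable (restrict_space borel X) (borel :: 'a measure)"
    by (rule measurable_restrict_space1) simp
  have [measurable]: "(\<lambda>w. fst w) \<in> measurable (restrict_space borel X \<Otimes>\<^sub>M borel) (borel :: 'a measure)"
    by (rule measurable_compose[OF measurable_fst]) simp
  have [measurable]: "(\<lambda>w. s (fst w) (snd w)) \<in> borel_measurable (restrict_space borel X \<Otimes>\<^sub>M borel)"
    using oracle_measurable by (simp add: case_prod_beta')
  have "(\<lambda>(p, z). fr p + s p z \<bullet> (u - p)) \<in> borel_measurable (restrict_space borel X \<Otimes>\<^sub>M borel)"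
    unfolding case_prod_beta' by measurable
  then show "expectation (\<lambda>\<omega>. fr (V \<omega>) + s (V \<omega>) (\<zeta> i \<omega>) \<bullet> (u - V \<omega>)) \<le> fr u"
  proof (rule expectation_V_le[OF _ int])
    fix p assume "p \<in> space (restrict_space borel X)"
    then have p: "p \<in> X"
      by (simp add: space_restrict_space)
    have "expectation (\<lambda>\<omega>. fr p + s p (\<zeta> i \<omega>) \<bullet> (u - p)) = fr p + expectation (\<lambda>\<omega>. s p (\<zeta> i \<omega>)) \<bullet> (u - p)"
      using oracle_mean(1)[OF p] by (simp add: prob_space)
    then show "expectation (\<lambda>\<omega>. fr p + s p (\<zeta> i \<omega>) \<bullet> (u - p)) \<le> fr u"
      using oracle_mean(3)[OF p u] by simp
  qed
qed

end

end

section \<open>Expected gap of SCPB1\<close>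

locale scpb1_run = stochastic_composite P \<xi> \<zeta> f h F s
  for P :: "'w measure" and \<xi> :: "'w \<Rightarrow> 'b::euclidean_space" and \<zeta> :: "nat \<Rightarrow> 'w \<Rightarrow> 'b"
    and f h :: "'a::euclidean_space \<Rightarrow> ereal" and F :: "'a \<Rightarrow> 'b \<Rightarrow> real" and s :: "'a \<Rightarrow> 'b \<Rightarrow> 'a" +
  fixes lam \<theta> R :: real and K :: nat and x0 :: 'a
    and j :: "'w \<Rightarrow> nat \<Rightarrow> nat" and S x y :: "'w \<Rightarrow> nat \<Rightarrow> 'a"
  assumes params: "lam > 0" "\<theta> > 0" "K \<ge> 1"
    and x0: "x0 \<in> edom h"
    and run: "\<And>\<omega>. \<omega> \<in> space P \<Longrightarrow>
      SCPB1 h s lam \<theta> K R x0 (\<lambda>i. \<zeta> i \<omega>) (j \<omega>) (S \<omega>) (x \<omega>) (y \<omega>)"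
begin

definition \<tau> :: real where "\<tau> = \<theta> * real K / (\<theta> * real K + 1)"
text \<open>The cycle rule does not involve the samples, so the cycle ends are the same for all outcomes.\<close>

definition J :: "nat \<Rightarrow> nat" where "J = j (SOME \<omega>. \<omega> \<in> space P)"
text \<open>\<open>len k\<close> counts the iterations of cycle \<open>k\<close> after its first
  one; it is the exponent in the stopping test.\<close>

definition len :: "nat \<Rightarrow> nat" where "len k = J k - Suc (J (k - 1))"

lemma \<tau>: "0 < \<tau>" "\<tau> < 1" and \<tau>_ratio: "(1 - \<tau>) / \<tau> = 1 / (\<theta> * real K)"
proof -
  have "\<theta> * real K > 0"
    using params by simp
  then show "0 < \<tau>" "\<tau> < 1" "(1 - \<tau>) / \<tau> = 1 / (\<theta> * real K)"
    by (auto simp: \<tau>_def divide_simps add_pos_pos)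
qed

lemma some_outcome: "(SOME \<omega>. \<omega> \<in> space P) \<in> space P"
  using not_empty by (simp add: some_in_eq)

lemma j_eq_J: "\<omega> \<in> space P \<Longrightarrow> k \<le> K \<Longrightarrow> j \<omega> k = J k"
  unfolding J_def using SCPB1_cycle_ends_deterministic[OF run run[OF some_outcome]] .

lemma J_0: "J 0 = 0"
  and J_less: "k \<in> {1..K} \<Longrightarrow> J (k - 1) < J k"
  unfolding J_def using SCPB_cycle_start[OF SCPB1_imp_SCPB[OF run[OF some_outcome]]] by auto

lemma J_len: "k \<in> {1..K} \<Longrightarrow> J k = J (k - 1) + Suc (len k)"
  using J_less[of k] by (simp add: len_def)

lemma \<tau>_len: "k \<in> {1..K} \<Longrightarrow> lam * real k * \<tau> ^ len k \<le> R"
  unfolding \<tau>_def len_def J_def using SCPB1_cycle_end(1)[OF run[OF some_outcome]] .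

lemma x_0: "\<omega> \<in> space P \<Longrightarrow> x \<omega> 0 = x0"
  using SCPB_cycle_start(2)[OF SCPB1_imp_SCPB[OF run]] .

definition g :: "nat \<Rightarrow> 'w \<Rightarrow> 'a" where "g i \<omega> = s (x \<omega> i) (\<zeta> i \<omega>)"

lemma cycle_step:
  assumes \<omega>: "\<omega> \<in> space P" and k: "k \<in> {1..K}" and t: "t \<le> len k"
  defines "b \<equiv> J (k - 1)"
  shows "prox_step X hr lam (ema \<tau> (\<lambda>t. g (b + t) \<omega>) t) (x \<omega> b) (x \<omega> (b + Suc t))"
    and "y \<omega> (b + Suc t) = ema \<tau> (\<lambda>t. x \<omega> (b + Suc t)) t"
proof -
  have jJ: "j \<omega> (k - 1) = b" "j \<omega> k = J k"
    using j_eq_J[OF \<omega>] k by (auto simp: b_def)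
  have "j \<omega> (k - 1) + t < j \<omega> k"
    unfolding jJ using J_len[OF k] t by (simp add: b_def)
  from SCPB_cycle[OF SCPB1_imp_SCPB[OF run[OF \<omega>]] h x0 k this]
  show "prox_step X hr lam (ema \<tau> (\<lambda>t. g (b + t) \<omega>) t) (x \<omega> b) (x \<omega> (b + Suc t))"
    and "y \<omega> (b + Suc t) = ema \<tau> (\<lambda>t. x \<omega> (b + Suc t)) t"
    unfolding jJ \<tau>_def g_def by simp_all
qed

text \<open>The cycle containing a positive iteration is the first one that ends at or after
  it.\<close>

lemma iteration_cases:
  assumes "i \<le> J K"
  obtains "i = 0" | k t where "k \<in> {1..K}" "t \<le> len k" "i = J (k - 1) + Suc t"
proof (cases "i = 0")
  case False
  define k where "k = (LEAST k. i \<le> J k)"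
  have k: "i \<le> J k"
    unfolding k_def using assms by (rule LeastI)
  have "k \<le> K"
    unfolding k_def using assms by (rule Least_le)
  moreover have "k \<noteq> 0"
    using k False J_0 by (cases "k = 0") auto
  ultimately have kK: "k \<in> {1..K}"
    by simp
  have "J (k - 1) < i"
    using not_less_Least[of "k - 1" "\<lambda>k. i \<le> J k"] \<open>k \<noteq> 0\<close> by (simp add: k_def)
  then have "i = J (k - 1) + Suc (i - Suc (J (k - 1)))" "i - Suc (J (k - 1)) \<le> len k"
    using k by (auto simp: len_def)
  with kK that(2) show thesis
    by blast
qed (rule that(1))

lemma J_mono:
  assumes "k \<le> k'" "k' \<le> K"
  shows "J k \<le> J k'"
  using assms
proof (induction k' rule: dec_induct)
  case (step n)
  then show ?case
    using J_less[of "Suc n"] by simp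
qed simp

text \<open>Iterate \<open>i\<close> is a nonexpansive image of the prox-center minus
  \<open>lam\<close> times the averaged subgradients, all built from samples with index below
  \<open>i\<close>. Hence it is independent of sample \<open>i\<close>, the one used in the oracle
  call at this iterate.\<close>

lemma iterate_past:
  assumes "i \<le> J K"
  shows "(\<lambda>\<omega>. x \<omega> i) \<in> measurable (past \<zeta> i) (restrict_space borel X)"
  using assms
proof (induction i rule: less_induct)
  case (less i)
  from less.prems show ?case
  proof (cases rule: iteration_cases)
    case 1
    have "(\<lambda>_. x0) \<in> measurable (past \<zeta> i) (restrict_space borel X)"
      using x0 by (intro measurable_const) (simp add: space_restrict_space)
    then show ?thesis
      using 1 x_0 by (subst measurable_cong[where g="\<lambda>_. x0"]) auto
  next
    case (2 k t)
    let ?b = "J (k - 1)"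
    have earlier: "(\<lambda>\<omega>. x \<omega> (?b + t')) \<in> measurable (past \<zeta> i) (restrict_space borel X)" if "t' \<le> t" for t'
      using less.IH[of "?b + t'"] less.prems 2(3) that by (auto intro: measurable_past_mono)
    have "g (?b + t') \<in> borel_measurable (past \<zeta> i)" if "t' \<le> t" for t'
      using measurable_compose[OF measurable_Pair[OF earlier[OF that] past_sample[of "?b + t'" i \<zeta>]] oracle_measurable]
        2(3) that by (simp add: g_def[abs_def])
    then have [measurable]: "(\<lambda>\<omega>. ema \<tau> (\<lambda>t. g (?b + t) \<omega>) t) \<in> borel_measurable (past \<zeta> i)"
      by (rule ema_measurable)
    have [measurable]: "(\<lambda>\<omega>. x \<omega> ?b) \<in> borel_measurable (past \<zeta> i)"
      using earlier[of 0] by (simp add: measurable_restrict_space2_iff)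
    let ?W = "\<lambda>\<omega>. x \<omega> ?b - lam *\<^sub>R ema \<tau> (\<lambda>t. g (?b + t) \<omega>) t"
    have "(\<lambda>\<omega>. x \<omega> i) \<in> borel_measurable (past \<zeta> i)"
    proof (rule borel_measurable_dominated_oscillation)
      show "?W \<in> borel_measurable (past \<zeta> i)"
        by measurable
      show "dist (x \<omega> i) (x \<omega>' i) \<le> dist (?W \<omega>) (?W \<omega>')"
        if "\<omega> \<in> space (past \<zeta> i)" "\<omega>' \<in> space (past \<zeta> i)" for \<omega> \<omega>'
        using prox_step_nonexpansive[OF convex_hr params(1)] cycle_step(1)[OF _ 2(1,2)] that
        unfolding 2(3) dist_norm by simp
    qed
    moreover have "x \<omega> i \<in> X" if "\<omega> \<in> space P" for \<omega>
      using cycle_step(1)[OF that 2(1,2)] by (simp add: prox_step_def 2(3))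
    ultimately show ?thesis
      by (intro measurable_restrict_space2) auto
  qed
qed

lemmas iterate_in_X = V_in_X[OF iterate_past]

lemma output_point:
  assumes \<omega>: "\<omega> \<in> space P" and k: "k \<in> {1..K}"
  shows "y \<omega> (J k) = ema \<tau> (\<lambda>t. x \<omega> (J (k - 1) + Suc t)) (len k)" and "y \<omega> (J k) \<in> X"
proof -
  show eq: "y \<omega> (J k) = ema \<tau> (\<lambda>t. x \<omega> (J (k - 1) + Suc t)) (len k)"
    using cycle_step(2)[OF \<omega> k order_refl] J_len[OF k] by simp
  show "y \<omega> (J k) \<in> X"
    unfolding eq using cycle_step(1)[OF \<omega> k] \<tau>
    by (intro ema_in_convex[OF convex_X]) (auto simp: prox_step_def)
qed

lemma output_point_measurable:
  assumes k: "k \<in> {1..K}"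
  shows "(\<lambda>\<omega>. y \<omega> (J k)) \<in> borel_measurable P"
proof -
  have "(\<lambda>\<omega>. x \<omega> (J (k - 1) + Suc t)) \<in> borel_measurable P" if "t \<le> len k" for t
    using J_mono[of k K] J_len[OF k] k that by (intro V_borel[OF iterate_past]) auto
  then have "(\<lambda>\<omega>. ema \<tau> (\<lambda>t. x \<omega> (J (k - 1) + Suc t)) (len k)) \<in> borel_measurable P"
    by (rule ema_measurable)
  then show ?thesis
    using output_point(1)[OF _ k] by (simp cong: measurable_cong)
qed

section \<open>Expected cost of one cycle\<close>

definition cut_noise :: "nat \<Rightarrow> nat \<Rightarrow> 'w \<Rightarrow> real" where
  "cut_noise b t \<omega> = (if t = 0 then (norm (g (b + t) \<omega>) + B) * d
     else (1 - \<tau>) / \<tau> * (lam / 2) * (norm (g (b + t) \<omega>) + B)\<^sup>2)"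

text \<open>The bound of \<open>cycle_bound\<close> without its proximal terms, which are kept apart
  because they telescope over the cycles.\<close>

definition cycle_majorant :: "'a \<Rightarrow> nat \<Rightarrow> 'w \<Rightarrow> real" where
  "cycle_majorant u k \<omega> = hr u
     + ema \<tau> (\<lambda>t. fr (x \<omega> (J (k - 1) + t)) + g (J (k - 1) + t) \<omega> \<bullet> (u - x \<omega> (J (k - 1) + t))) (len k)
     + ema \<tau> (\<lambda>t. cut_noise (J (k - 1)) t \<omega>) (len k)"

lemma cycle_majorizes:
  assumes \<omega>: "\<omega> \<in> space P" and k: "k \<in> {1..K}" and u: "u \<in> X"
  shows "fr (y \<omega> (J k)) + hr (y \<omega> (J k)) \<le> cycle_majorant u k \<omega>
    + 1 / (2 * lam) * ((norm (u - x \<omega> (J (k - 1))))\<^sup>2 - (norm (u - x \<omega> (J k)))\<^sup>2)"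
proof -
  let ?b = "J (k - 1)"
  have x: "x \<omega> (?b + 0) \<in> X"
    using k by (auto intro!: iterate_in_X[OF _ \<omega>] J_mono)
  have step: "prox_step X hr lam (ema \<tau> (\<lambda>t. g (?b + t) \<omega>) t) (x \<omega> (?b + 0)) (x \<omega> (?b + Suc t))"
    if "t \<le> len k" for t
    using cycle_step(1)[OF \<omega> k that] by simp
  have "fr (y \<omega> (J k)) + hr (y \<omega> (J k)) + 1 / (2 * lam) * (norm (u - x \<omega> (J k)))\<^sup>2
      \<le> cycle_majorant u k \<omega> + 1 / (2 * lam) * (norm (u - x \<omega> ?b))\<^sup>2"
    using cycle_bound[where x="\<lambda>t. x \<omega> (?b + t)" and g="\<lambda>t. g (?b + t) \<omega>" and n="len k",
        OF convex_fr convex_hr params(1) \<tau> f_lipschitz norm_diff_le_diameter B_nonneg x step u]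
    unfolding output_point(1)[OF \<omega> k] cycle_majorant_def cut_noise_def J_len[OF k, symmetric] add_0_right
    by linarith
  then show ?thesis
    by (simp add: right_diff_distrib)
qed

text \<open>The mean of each linearization is at most \<open>fr u\<close>. The moment bounds give at
  most \<open>2 * B * d\<close> for the first noise term and \<open>4 * B\<^sup>2\<close> for the
  later squares; the factor \<open>1 / (\<theta> * K)\<close> comes from
  \<open>\<tau>_ratio\<close>.\<close>

lemma cycle_majorant_expectation:
  assumes k: "k \<in> {1..K}" and u: "u \<in> X"
  shows "integrable P (cycle_majorant u k)"
    and "expectation (cycle_majorant u k)
      \<le> fr u + hr u + \<tau> ^ len k * (2 * B * d) + 2 * lam * B\<^sup>2 / (\<theta> * real K)"
proof -
  let ?b = "J (k - 1)"
  let ?q = "(1 - \<tau>) / \<tau> * (lam / 2)"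
  let ?l = "\<lambda>t \<omega>. fr (x \<omega> (?b + t)) + g (?b + t) \<omega> \<bullet> (u - x \<omega> (?b + t))"
  have q: "0 \<le> ?q"
    using \<tau> params by simp
  have d: "0 \<le> d"
    using bounded_edom by (rule diameter_ge_0)
  have past: "(\<lambda>\<omega>. x \<omega> (?b + t)) \<in> measurable (past \<zeta> (?b + t)) (restrict_space borel X)" if "t \<le> len k" for t
    using J_mono[of k K] J_len[OF k] k that by (intro iterate_past) auto
  have lin: "integrable P (?l t)" "expectation (?l t) \<le> fr u" if "t \<le> len k" for t
    using V_linearization[OF past[OF that] u] by (simp_all add: g_def)
  have n1: "integrable P (\<lambda>\<omega>. norm (g (?b + t) \<omega>))" "expectation (\<lambda>\<omega>. norm (g (?b + t) \<omega>)) \<le> B"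
    and n2: "integrable P (\<lambda>\<omega>. (norm (g (?b + t) \<omega>))\<^sup>2)" "expectation (\<lambda>\<omega>. (norm (g (?b + t) \<omega>))\<^sup>2) \<le> B\<^sup>2"
    if "t \<le> len k" for t
    using V_first_moment[OF past[OF that]] V_second_moment[OF past[OF that]] by (simp_all add: g_def)
  have sq: "integrable P (\<lambda>\<omega>. (norm (g (?b + t) \<omega>) + B)\<^sup>2)"
    "expectation (\<lambda>\<omega>. (norm (g (?b + t) \<omega>) + B)\<^sup>2) \<le> 4 * B\<^sup>2" if "t \<le> len k" for t
  proof -
    show "integrable P (\<lambda>\<omega>. (norm (g (?b + t) \<omega>) + B)\<^sup>2)"
      unfolding power2_sum using n1[OF that] n2[OF that] by simp
    have "expectation (\<lambda>\<omega>. (norm (g (?b + t) \<omega>) + B)\<^sup>2)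
        = expectation (\<lambda>\<omega>. (norm (g (?b + t) \<omega>))\<^sup>2) + B\<^sup>2 + 2 * expectation (\<lambda>\<omega>. norm (g (?b + t) \<omega>)) * B"
      unfolding power2_sum using n1[OF that] n2[OF that] by (simp add: prob_space)
    also have "\<dots> \<le> B\<^sup>2 + B\<^sup>2 + 2 * B * B"
      using n1(2)[OF that] n2(2)[OF that] B_nonneg by (intro add_mono mult_right_mono) auto
    finally show "expectation (\<lambda>\<omega>. (norm (g (?b + t) \<omega>) + B)\<^sup>2) \<le> 4 * B\<^sup>2"
      by (simp add: power2_eq_square)
  qed
  have noise: "integrable P (cut_noise ?b t)"
    "expectation (cut_noise ?b t) \<le> (if t = 0 then 2 * B * d else ?q * (4 * B\<^sup>2))" if "t \<le> len k" for t
  proof -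
    show "integrable P (cut_noise ?b t)"
      unfolding cut_noise_def[abs_def] using n1(1)[OF that] sq(1)[OF that]
      by (cases "t = 0") (simp_all del: One_nat_def)
    show "expectation (cut_noise ?b t) \<le> (if t = 0 then 2 * B * d else ?q * (4 * B\<^sup>2))"
    proof (cases "t = 0")
      case True
      have "expectation (cut_noise ?b t) = (expectation (\<lambda>\<omega>. norm (g (?b + t) \<omega>)) + B) * d"
        unfolding cut_noise_def[abs_def] using n1(1)[OF that] True by (simp add: prob_space)
      also have "\<dots> \<le> (2 * B) * d"
        using n1(2)[OF that] d by (intro mult_right_mono) auto
      finally show ?thesis
        using True by simp
    next
      case False
      have "expectation (cut_noise ?b t) = ?q * expectation (\<lambda>\<omega>. (norm (g (?b + t) \<omega>) + B)\<^sup>2)"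
        unfolding cut_noise_def[abs_def] using False by simp
      also have "\<dots> \<le> ?q * (4 * B\<^sup>2)"
        using sq(2)[OF that] q by (rule mult_left_mono)
      finally show ?thesis
        using False by simp
    qed
  qed
  have int: "integrable P (\<lambda>\<omega>. ema \<tau> (\<lambda>t. ?l t \<omega>) (len k))" "integrable P (\<lambda>\<omega>. ema \<tau> (\<lambda>t. cut_noise ?b t \<omega>) (len k))"
    using lin(1) noise(1) by (auto intro!: integrable_ema)
  then show "integrable P (cycle_majorant u k)"
    unfolding cycle_majorant_def[abs_def] by simp
  have "expectation (\<lambda>\<omega>. ema \<tau> (\<lambda>t. ?l t \<omega>) (len k)) = ema \<tau> (\<lambda>t. expectation (?l t)) (len k)"
    using lin(1) by (rule integral_ema)
  moreover have "expectation (\<lambda>\<omega>. ema \<tau> (\<lambda>t. cut_noise ?b t \<omega>) (len k))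
      = ema \<tau> (\<lambda>t. expectation (cut_noise ?b t)) (len k)"
    using noise(1) by (rule integral_ema)
  ultimately have "expectation (cycle_majorant u k)
      = hr u + ema \<tau> (\<lambda>t. expectation (?l t)) (len k) + ema \<tau> (\<lambda>t. expectation (cut_noise ?b t)) (len k)"
    unfolding cycle_majorant_def[abs_def] using int by (simp add: prob_space del: One_nat_def)
  also have "ema \<tau> (\<lambda>t. expectation (?l t)) (len k) \<le> fr u"
    using ema_mono[of \<tau> "len k" "\<lambda>t. expectation (?l t)" "\<lambda>_. fr u"] lin(2) \<tau> by (simp add: ema_const)
  also have "ema \<tau> (\<lambda>t. expectation (cut_noise ?b t)) (len k)
      \<le> \<tau> ^ len k * (2 * B * d) + (1 - \<tau> ^ len k) * (?q * (4 * B\<^sup>2))"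
    unfolding ema_first_rest[symmetric] using noise(2) \<tau> by (intro ema_mono) auto
  \<comment> \<open>The total weight of the later steps is relaxed to 1.\<close>
  also have "(1 - \<tau> ^ len k) * (?q * (4 * B\<^sup>2)) \<le> 1 * (?q * (4 * B\<^sup>2))"
  proof (rule mult_right_mono)
    show "0 \<le> ?q * (4 * B\<^sup>2)"
      using q by (rule mult_nonneg_nonneg) simp
  qed (use \<tau> in simp)
  finally show "expectation (cycle_majorant u k)
      \<le> fr u + hr u + \<tau> ^ len k * (2 * B * d) + 2 * lam * B\<^sup>2 / (\<theta> * real K)"
    unfolding \<tau>_ratio by (simp add: algebra_simps)
qed

section \<open>Averaging over the second half of the cycles\<close>

definition window :: "nat set" where "window = {K div 2 + 1..K}"
definition out :: "'w \<Rightarrow> 'a" where "out \<omega> = (1 / real (card window)) *\<^sub>R (\<Sum>k\<in>window. y \<omega> (J k))"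

lemma SCPB_output_eq:
  assumes "\<omega> \<in> space P"
  shows "SCPB_output K (j \<omega>) (y \<omega>) = out \<omega>"
proof -
  have "of_int \<lceil>real K / 2\<rceil> = real (card window)"
  proof -
    have "\<lceil>real K / 2\<rceil> = int (K - K div 2)"
      by (rule ceiling_unique; cases "even K") (auto elim!: evenE oddE)
    then show ?thesis
      by (simp add: window_def)
  qed
  moreover have "(\<Sum>k = K div 2 + 1..K. y \<omega> (j \<omega> k)) = (\<Sum>k\<in>window. y \<omega> (J k))"
    using j_eq_J[OF assms] by (intro sum.cong) (auto simp: window_def)
  ultimately show ?thesis
    by (simp add: SCPB_output_def out_def)
qed

lemma window: "finite window" "window \<subseteq> {1..K}" "real K / 2 \<le> real (card window)" "card window > 0"
proof -
  show "real K / 2 \<le> real (card window)" "card window > 0"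
    using params(3) by (auto simp: window_def)
qed (auto simp: window_def)

lemma out_in_X:
  assumes "\<omega> \<in> space P"
  shows "out \<omega> \<in> X"
proof -
  have "(\<Sum>k\<in>window. (1 / real (card window)) *\<^sub>R y \<omega> (J k)) \<in> X"
    using window output_point(2)[OF assms] by (intro convex_sum[OF _ convex_X]) auto
  then show ?thesis
    by (simp add: out_def scaleR_sum_right)
qed

lemma out_measurable [measurable]: "out \<in> borel_measurable P"
  unfolding out_def[abs_def] using output_point_measurable window(2)
  by (intro borel_measurable_scaleR borel_measurable_const borel_measurable_sum) auto

text \<open>Jensen for the uniform average, then the bounds for the single cycles: the proximal
  terms telescope and leave one squared distance, at most \<open>d\<^sup>2\<close>.\<close>

lemma out_majorized:
  assumes \<omega>: "\<omega> \<in> space P" and u: "u \<in> X"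
  shows "fr (out \<omega>) + hr (out \<omega>)
    \<le> 1 / real (card window) * (d\<^sup>2 / (2 * lam) + (\<Sum>k\<in>window. cycle_majorant u k \<omega>))"
proof -
  let ?\<delta> = "\<lambda>k. (norm (u - x \<omega> (J k)))\<^sup>2"
  have "(\<lambda>v. fr v + hr v) (\<Sum>k\<in>window. (1 / real (card window)) *\<^sub>R y \<omega> (J k))
      \<le> (\<Sum>k\<in>window. 1 / real (card window) * (fr (y \<omega> (J k)) + hr (y \<omega> (J k))))"
    using window output_point(2)[OF \<omega>]
    by (intro convex_on_sum[OF _ _ convex_on_add[OF convex_fr convex_hr]]) auto
  then have "fr (out \<omega>) + hr (out \<omega>) \<le> 1 / real (card window) * (\<Sum>k\<in>window. fr (y \<omega> (J k)) + hr (y \<omega> (J k)))"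
    unfolding out_def scaleR_sum_right sum_distrib_left .
  also have "(\<Sum>k\<in>window. fr (y \<omega> (J k)) + hr (y \<omega> (J k)))
      \<le> (\<Sum>k\<in>window. cycle_majorant u k \<omega> + 1 / (2 * lam) * (?\<delta> (k - 1) - ?\<delta> k))"
    using window(2) cycle_majorizes[OF \<omega> _ u] by (intro sum_mono) auto
  also have "\<dots> = (\<Sum>k\<in>window. cycle_majorant u k \<omega>) - 1 / (2 * lam) * (\<Sum>k\<in>window. ?\<delta> k - ?\<delta> (k - 1))"
    by (simp add: sum.distrib sum_subtractf sum_distrib_left algebra_simps)
  \<comment> \<open>The window starts at \<open>K div 2 + 1\<close>, so its first prox-center is the
    end of cycle \<open>K div 2\<close>; for \<open>K = 1\<close> this is the starting
    point.\<close>
  also have "(\<Sum>k\<in>window. ?\<delta> k - ?\<delta> (k - 1)) = ?\<delta> K - ?\<delta> (K div 2)"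
    using sum_telescope''[of "K div 2" K ?\<delta>] by (simp add: window_def)
  also have "(\<Sum>k\<in>window. cycle_majorant u k \<omega>) - 1 / (2 * lam) * (?\<delta> K - ?\<delta> (K div 2))
      \<le> d\<^sup>2 / (2 * lam) + (\<Sum>k\<in>window. cycle_majorant u k \<omega>)"
  proof -
    have "?\<delta> (K div 2) \<le> d\<^sup>2"
      using norm_diff_le_diameter[OF u iterate_in_X[OF _ \<omega>]] J_mono[of "K div 2" K] by (intro power_mono) auto
    then have "?\<delta> (K div 2) - ?\<delta> K \<le> d\<^sup>2"
      using zero_le_power2[of "norm (u - x \<omega> (J K))"] by linarith
    then have "1 / (2 * lam) * (?\<delta> (K div 2) - ?\<delta> K) \<le> 1 / (2 * lam) * d\<^sup>2"
      using params by (intro mult_left_mono) auto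
    then show ?thesis
      by (simp add: algebra_simps)
  qed
  finally show ?thesis
    by (simp add: mult_left_mono divide_right_mono)
qed

text \<open>In the window \<open>K <= 2 * k\<close>, so the stopping test for \<open>k\<close> holds
  with \<open>K\<close> in place of \<open>k\<close> once \<open>R\<close> is doubled.\<close>

lemma window_decay:
  "(\<Sum>k\<in>window. \<tau> ^ len k) \<le> real (card window) * (2 * R / (lam * real K))"
proof -
  have "\<tau> ^ len k \<le> 2 * R / (lam * real K)" if k: "k \<in> window" for k
  proof -
    have kK: "k \<in> {1..K}"
      using k window(2) by blast
    have "real K \<le> 2 * real k"
      using k by (auto simp: window_def)
    then have "lam * real K * \<tau> ^ len k \<le> lam * (2 * real k) * \<tau> ^ len k"
      using params \<tau> by (intro mult_right_mono mult_left_mono) auto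
    also have "\<dots> \<le> 2 * R"
      using \<tau>_len[OF kK] by simp
    finally show ?thesis
      using params by (simp add: field_simps)
  qed
  from sum_bounded_above[of window, OF this] show ?thesis
    by simp
qed

theorem expected_gap:
  assumes u: "u \<in> X" and min: "\<And>v. v \<in> X \<Longrightarrow> fr u + hr u \<le> fr v + hr v"
  shows "integrable P (\<lambda>\<omega>. fr (out \<omega>) + hr (out \<omega>))"
    and "expectation (\<lambda>\<omega>. fr (out \<omega>) + hr (out \<omega>)) - (fr u + hr u)
      \<le> d\<^sup>2 / (lam * real K) + 4 * B * d * R / (lam * real K) + 2 * lam * B\<^sup>2 / (\<theta> * real K)"
proof -
  let ?N = "real (card window)"
  let ?c = "fr u + hr u"
  define U where "U \<omega> = 1 / ?N * (d\<^sup>2 / (2 * lam) + (\<Sum>k\<in>window. cycle_majorant u k \<omega>))" for \<omega>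
  have N: "?N > 0"
    using window(4) by simp
  have majint: "integrable P (cycle_majorant u k)" if "k \<in> window" for k
    using cycle_majorant_expectation(1)[OF _ u] window(2) that by auto
  then have U: "integrable P U"
    unfolding U_def[abs_def] by simp
  have le: "fr (out \<omega>) + hr (out \<omega>) \<le> U \<omega>" if "\<omega> \<in> space P" for \<omega>
    unfolding U_def using that u by (rule out_majorized)
  \<comment> \<open>Minimality of \<open>u\<close> bounds the objective from below by a constant;
    together with the integrable upper bound \<open>U\<close> this makes it integrable.\<close>
  have ge: "?c \<le> fr (out \<omega>) + hr (out \<omega>)" if "\<omega> \<in> space P" for \<omega>
    using min[OF out_in_X[OF that]] .
  show int: "integrable P (\<lambda>\<omega>. fr (out \<omega>) + hr (out \<omega>))"
  proof (rule Bochner_Integration.integrable_bound)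
    show "integrable P (\<lambda>\<omega>. \<bar>U \<omega>\<bar> + \<bar>?c\<bar>)"
      using U by simp
    have "norm (fr (out \<omega>) + hr (out \<omega>)) \<le> norm (\<bar>U \<omega>\<bar> + \<bar>?c\<bar>)" if "\<omega> \<in> space P" for \<omega>
      using le[OF that] ge[OF that] unfolding real_norm_def by linarith
    then show "AE \<omega> in P. norm (fr (out \<omega>) + hr (out \<omega>)) \<le> norm (\<bar>U \<omega>\<bar> + \<bar>?c\<bar>)"
      by (rule AE_I2)
  qed measurable
  have "expectation (\<lambda>\<omega>. fr (out \<omega>) + hr (out \<omega>)) \<le> expectation U"
    using int U le by (rule integral_mono)
  also have "\<dots> = 1 / ?N * (d\<^sup>2 / (2 * lam) + (\<Sum>k\<in>window. expectation (cycle_majorant u k)))"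
    unfolding U_def[abs_def] using majint by (simp add: prob_space)
  also have "\<dots> \<le> 1 / ?N * (d\<^sup>2 / (2 * lam) +
      (\<Sum>k\<in>window. ?c + \<tau> ^ len k * (2 * B * d) + 2 * lam * B\<^sup>2 / (\<theta> * real K)))"
    using cycle_majorant_expectation(2)[OF _ u] window(2) by (intro mult_left_mono add_left_mono sum_mono) auto
  also have "\<dots> = 1 / ?N * (d\<^sup>2 / (2 * lam) + ?N * (?c + 2 * lam * B\<^sup>2 / (\<theta> * real K))
      + (\<Sum>k\<in>window. \<tau> ^ len k) * (2 * B * d))"
    by (simp add: sum.distrib flip: sum_distrib_right) (simp add: algebra_simps)
  also have "\<dots> \<le> 1 / ?N * (?N * (d\<^sup>2 / (lam * real K)) + ?N * (?c + 2 * lam * B\<^sup>2 / (\<theta> * real K))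
      + ?N * (2 * R / (lam * real K)) * (2 * B * d))"
  \<comment> \<open>The window holds at least \<open>K / 2\<close> cycles; dividing by their number
    turns \<open>d\<^sup>2 / (2 * lam)\<close> into at most
    \<open>d\<^sup>2 / (lam * K)\<close>.\<close>
  proof (intro mult_left_mono add_mono mult_right_mono window_decay)
    have "1 / (2 * lam) * d\<^sup>2 = real K / 2 * (d\<^sup>2 / (lam * real K))"
      using params by (simp add: field_simps)
    also have "\<dots> \<le> ?N * (d\<^sup>2 / (lam * real K))"
      using window(3) params by (intro mult_right_mono) auto
    finally show "d\<^sup>2 / (2 * lam) \<le> ?N * (d\<^sup>2 / (lam * real K))"
      by simp
    show "0 \<le> 2 * B * d"
      using B_nonneg diameter_ge_0[OF bounded_edom] by simp
  qed auto
  also have "\<dots> = 1 / ?N * (?N * (d\<^sup>2 / (lam * real K) + (?c + 2 * lam * B\<^sup>2 / (\<theta> * real K))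
      + 4 * B * d * R / (lam * real K)))"
    by (simp add: algebra_simps)
  also have "\<dots> = d\<^sup>2 / (lam * real K) + (?c + 2 * lam * B\<^sup>2 / (\<theta> * real K)) + 4 * B * d * R / (lam * real K)"
    using N by simp
  finally show "expectation (\<lambda>\<omega>. fr (out \<omega>) + hr (out \<omega>)) - (fr u + hr u)
      \<le> d\<^sup>2 / (lam * real K) + 4 * B * d * R / (lam * real K) + 2 * lam * B\<^sup>2 / (\<theta> * real K)"
    by simp
qed

end

section \<open>The choice of parameters\<close>

lemma gap_constants:
  fixes d B D M C :: real and K :: nat
  assumes C: "C > 0" and K: "K > 0" and D: "D > 0" and M: "M > 0"
  defines "lam \<equiv> sqrt C * D / (M * sqrt (real K))"
  shows "d\<^sup>2 / (lam * real K) + 4 * B * d * (D / M) / (lam * real K) + 2 * lam * B\<^sup>2 / (C / real K * real K)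
    \<le> (4 * (d\<^sup>2 / D\<^sup>2) + 5 * (B\<^sup>2 / M\<^sup>2)) * D * M / sqrt (C * real K)"
proof -
  \<comment> \<open>In terms of \<open>r\<close> the parameters satisfy
    \<open>lam * K = r * D / M\<close> and \<open>lam / C = D / (M * r)\<close>, so all three terms
    become multiples of \<open>1 / r\<close>.\<close>
  define r where "r = sqrt (C * real K)"
  have r: "r > 0" "r * r = C * real K"
    using C K by (simp_all add: r_def)
  have "sqrt C * real K = r * sqrt (real K)"
    by (simp add: r_def real_sqrt_mult)
  then have lam: "lam * real K = r * D / M"
    using K D M by (simp add: lam_def field_simps)
  have "lam = lam * real K / real K"
    using K by simp
  then have "lam = r * D / (M * real K)"
    unfolding lam by simp
  then have "lam / C = r * D / (M * (r * r))"
    unfolding r(2) by (simp add: ac_simps)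
  also have "\<dots> = D / (M * r)"
    using r(1) by simp
  finally have lamC: "lam / C = D / (M * r)" .
  \<comment> \<open>The mixed term \<open>4 * B * d\<close> is split by the arithmetic-geometric
    mean inequality. The coefficients become 3 and 4, within the claimed 4 and 5.\<close>
  have "0 \<le> (d * M - B * D)\<^sup>2 / (D * M)"
    using D M by simp
  also have "\<dots> = d\<^sup>2 * M / D + B\<^sup>2 * D / M - 2 * B * d"
    using D M by (simp add: field_simps power2_eq_square)
  finally have amgm: "4 * B * d \<le> 2 * (d\<^sup>2 * M / D) + 2 * (B\<^sup>2 * D / M)"
    by simp
  have "d\<^sup>2 / (lam * real K) + 4 * B * d * (D / M) / (lam * real K) + 2 * lam * B\<^sup>2 / (C / real K * real K)
      = d\<^sup>2 / (r * D / M) + 4 * B * d * (D / M) / (r * D / M) + 2 * B\<^sup>2 * (lam / C)"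
    unfolding lam using K by simp
  also have "\<dots> = (d\<^sup>2 * M / D + 4 * B * d + 2 * (B\<^sup>2 * D / M)) / r"
    unfolding lamC using r D M by (simp add: field_simps)
  also have "\<dots> \<le> (4 * (d\<^sup>2 * M / D) + 5 * (B\<^sup>2 * D / M)) / r"
  proof (rule divide_right_mono)
    have slack: "p + t + 2 * q \<le> 4 * p + 5 * q" if "t \<le> 2 * p + 2 * q" "0 \<le> p" "0 \<le> q" for p q t :: real
      using that by linarith
    show "d\<^sup>2 * M / D + 4 * B * d + 2 * (B\<^sup>2 * D / M) \<le> 4 * (d\<^sup>2 * M / D) + 5 * (B\<^sup>2 * D / M)"
      using amgm by (rule slack) (use D M in simp_all)
  qed (use r in simp)
  also have "\<dots> = (4 * (d\<^sup>2 / D\<^sup>2) + 5 * (B\<^sup>2 / M\<^sup>2)) * D * M / r"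
    using D M r(1) by (simp add: field_simps power2_eq_square)
  finally show ?thesis
    unfolding r_def .
qed

text \<open>Finiteness almost everywhere and integrability are part of the claim because
  \<open>real_of_ereal\<close> sends infinite values to 0 and the Bochner integral of a
  non-integrable function is 0. The absolute constant 2 serves both complexity bounds.\<close>

theorem corollary3p3:
  fixes P :: "'w measure"
    and \<xi> :: "'w \<Rightarrow> 'b::euclidean_space"
    and \<zeta> :: "nat \<Rightarrow> 'w \<Rightarrow> 'b"
    and f h :: "real ^ 'n \<Rightarrow> ereal"
    and F :: "real ^ 'n \<Rightarrow> 'b \<Rightarrow> real"
    and s :: "real ^ 'n \<Rightarrow> 'b \<Rightarrow> real ^ 'n"
    and x0 :: "real ^ 'n"
    and K :: nat
    and C D M \<theta> R lam \<kappa>D \<kappa>M :: real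
    and \<phi> :: "real ^ 'n \<Rightarrow> ereal"
    and j :: "'w \<Rightarrow> nat \<Rightarrow> nat"
    and S x y :: "'w \<Rightarrow> nat \<Rightarrow> real ^ 'n"
  assumes prob: "prob_space P"
    and xi: "\<xi> \<in> borel_measurable P"
    and samples_indep: "prob_space.indep_vars P (\<lambda>_. borel) \<zeta> UNIV"
    and samples_law: "\<And>i. distr P borel (\<zeta> i) = distr P borel \<xi>"
    and phi: "\<phi> = (\<lambda>u. f u + h u)"
    and A1: "proper_closed_convex f" "proper_closed_convex h" "edom h \<subseteq> edom f"
    and A2: "stochastic_oracles P \<xi> f h F s"
    and A3: "finite_oracle_bound P \<xi> h s"
    and A4: "optimal_solutions \<phi> \<noteq> {}"
    and diam: "bounded (edom h)" "diameter (edom h) > 0"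
    and params: "K \<ge> 1" "C \<ge> 1" "D > 0" "M > 0"
    and theta: "\<theta> = C / real K"
    and R: "R = D / M"
    and lam: "lam = sqrt C * D / (M * sqrt (real K))"
    and kappaD: "\<kappa>D = (diameter (edom h))\<^sup>2 / D\<^sup>2"
    and kappaM: "\<kappa>M = (oracle_bound P \<xi> h s)\<^sup>2 / M\<^sup>2"
    and x0: "x0 \<in> edom h"
    and run: "\<And>\<omega>. \<omega> \<in> space P \<Longrightarrow>
      SCPB1 h s lam \<theta> K R x0 (\<lambda>i. \<zeta> i \<omega>) (j \<omega>) (S \<omega>) (x \<omega>) (y \<omega>)"
  shows
    "((AE \<omega> in P. \<bar>\<phi> (SCPB_output K (j \<omega>) (y \<omega>))\<bar> \<noteq> \<infinity>) \<and>
      integrable P (\<lambda>\<omega>. real_of_ereal (\<phi> (SCPB_output K (j \<omega>) (y \<omega>)))) \<and>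
      ereal (\<integral>\<omega>. real_of_ereal (\<phi> (SCPB_output K (j \<omega>) (y \<omega>))) \<partial>P) - (INF u. \<phi> u)
        \<le> ereal ((4 * \<kappa>D + 5 * \<kappa>M) * D * M / sqrt (C * real K)))
     \<and>
     (\<forall>\<omega>\<in>space P. \<forall>k\<in>{1..K}.
        int (card {j \<omega> (k - 1) + 1..j \<omega> k})
          \<le> \<lceil>(C + 1) * ln0p (sqrt C * real k / sqrt (real K))\<rceil> + 1 \<and>
        real (card {j \<omega> (k - 1) + 1..j \<omega> k})
          \<le> 2 * (C * (1 + ln0p (sqrt C * real k / sqrt (real K)))))
     \<and>
     (integrable P (\<lambda>\<omega>. real (\<Sum>k = 1..K. card {j \<omega> (k - 1) + 1..j \<omega> k})) \<and>
      (\<integral>\<omega>. real (\<Sum>k = 1..K. card {j \<omega> (k - 1) + 1..j \<omega> k}) \<partial>P)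
        \<le> 2 * (C * real K * (1 + ln0p (sqrt (C * real K)))))"
proof -
  note pos = params
  have K: "real K > 0"
    using pos by simp
  interpret prob_space P
    by (rule prob)
  interpret scpb1_run P \<xi> \<zeta> f h F s lam \<theta> R K x0 j S x y
    using xi samples_indep samples_law A1 A2 A3 diam(1) params x0 run
    by unfold_locales (auto simp: lam theta)
  have fh: "\<phi> v = ereal (fr v + hr v)" if "v \<in> X" for v
  proof -
    have "f v = ereal (fr v)" "h v = ereal (hr v)"
      using proper_closed_convex_real[OF f] proper_closed_convex_real[OF h] edom_subset that by blast+
    then show ?thesis
      unfolding phi by (metis plus_ereal.simps(1))
  qed
  have \<phi>_out: "\<phi> (SCPB_output K (j \<omega>) (y \<omega>)) = ereal (fr (out \<omega>) + hr (out \<omega>))" if "\<omega> \<in> space P" for \<omega>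
    using fh[OF out_in_X[OF that]] SCPB_output_eq[OF that] by simp
  obtain u where "is_arg_min \<phi> (\<lambda>_. True) u"
    using A4 by (auto simp: optimal_solutions_def)
  then have min: "\<phi> u \<le> \<phi> v" for v
    by (auto simp: is_arg_min_def not_less)
  \<comment> \<open>\<open>\<phi>\<close> is finite at \<open>x0\<close>, so a minimizer cannot lie
    outside the domain of \<open>h\<close>.\<close>
  have u: "u \<in> X"
  proof (rule ccontr)
    assume "u \<notin> X"
    then have "h u = \<infinity>"
      by (auto simp: edom_def)
    then have "\<phi> u = \<infinity>"
      using f by (auto simp: phi proper_closed_convex_def)
    with min[of x0] fh[OF x0] show False
      by simp
  qed
  have inf: "(INF u. \<phi> u) = ereal (fr u + hr u)"
    unfolding fh[OF u, symmetric] using min by (intro antisym INF_lower INF_greatest) auto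
  have "fr u + hr u \<le> fr v + hr v" if "v \<in> X" for v
    using min[of v] fh[OF u] fh[OF that] by simp
  note gap = expected_gap[OF u this]
  have int: "integrable P (\<lambda>\<omega>. real_of_ereal (\<phi> (SCPB_output K (j \<omega>) (y \<omega>))))"
    using gap(1) by (subst Bochner_Integration.integrable_cong[OF refl]) (simp_all add: \<phi>_out)
  have "expectation (\<lambda>\<omega>. real_of_ereal (\<phi> (SCPB_output K (j \<omega>) (y \<omega>))))
      = expectation (\<lambda>\<omega>. fr (out \<omega>) + hr (out \<omega>))"
    by (rule Bochner_Integration.integral_cong) (simp_all add: \<phi>_out)
  moreover have "d\<^sup>2 / (lam * real K) + 4 * B * d * R / (lam * real K) + 2 * lam * B\<^sup>2 / (\<theta> * real K)
      \<le> (4 * \<kappa>D + 5 * \<kappa>M) * D * M / sqrt (C * real K)"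
    unfolding lam theta R kappaD kappaM using pos by (intro gap_constants) auto
  ultimately have "ereal (expectation (\<lambda>\<omega>. real_of_ereal (\<phi> (SCPB_output K (j \<omega>) (y \<omega>))))) - (INF u. \<phi> u)
      \<le> ereal ((4 * \<kappa>D + 5 * \<kappa>M) * D * M / sqrt (C * real K))"
    using gap(2) unfolding inf by simp
  moreover have "AE \<omega> in P. \<bar>\<phi> (SCPB_output K (j \<omega>) (y \<omega>))\<bar> \<noteq> \<infinity>"
    by (rule AE_I2) (simp add: \<phi>_out)
  moreover note run' = run[unfolded lam theta R]
  have "int (card {j \<omega> (k - 1) + 1..j \<omega> k}) \<le> \<lceil>(C + 1) * ln0p (sqrt C * real k / sqrt (real K))\<rceil> + 1 \<and>
      real (card {j \<omega> (k - 1) + 1..j \<omega> k}) \<le> 2 * (C * (1 + ln0p (sqrt C * real k / sqrt (real K))))"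
    if "\<omega> \<in> space P" "k \<in> {1..K}" for \<omega> k
    using cycle_length_bounds[OF pos(2-4) run'[OF that(1)] that(2)] by blast
  moreover
  let ?total = "\<lambda>j. real (\<Sum>k = 1..K. card {j (k - 1) + 1..j k})"
  \<comment> \<open>The cycle ends do not depend on the outcome, so the expected number of
    iterations is that of any single run.\<close>
  have total: "?total (j \<omega>) = ?total J" if "\<omega> \<in> space P" for \<omega>
    using j_eq_J[OF that] by (intro arg_cong[where f=real] sum.cong) auto
  then have "integrable P (\<lambda>\<omega>. ?total (j \<omega>))"
    by (subst Bochner_Integration.integrable_cong[OF refl, of _ _ "\<lambda>_. ?total J"]) auto
  moreover from this have "(\<integral>\<omega>. ?total (j \<omega>) \<partial>P) \<le> 2 * (C * real K * (1 + ln0p (sqrt (C * real K))))"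
    using total_length_bound[OF pos(2-4) run'] by (intro integral_le_const AE_I2)
  ultimately show ?thesis
    using int by blast
qed

end
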